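(* Let $(q_n),(r_n)$ be complex sequences vanishing faster than any negative power of $|n|$ as $n\to\pm\infty$ with $1-q_nr_n\neq0$ and $1+q_nr_{n+1}\ne0$ for all $n$, and let $u_n,v_n,p_n,s_n,D_\infty,E_\infty$ be as in the context. Let $z_j$ ($0<|z_j|<1$) be a common pole of multiplicity $m_j$ of $T^{(q,r)}$, $T_{\rm r}^{(u,v)}$, $T_{\rm r}^{(p,s)}$, and let $\bar z_j$ ($|\bar z_j|>1$) be a common pole of multiplicity $\bar m_j$ of $\bar T^{(q,r)}$, $\bar T_{\rm r}^{(u,v)}$, $\bar T_{\rm r}^{(p,s)}$. With $\sigma(z):=1/(1-z^{-2})$, the dependency constants satisfy, for $0\le k\le m_j-1$, $$D_\infty\gamma_{jk}^{(q,r)}=\gamma_{jk}^{(p,s)},\qquad D_\infty\gamma_{jk}^{(q,r)}=\sum_{l=0}^k\binom kl\frac{d^l\sigma(z_j)}{dz^l}\,\gamma^{(u,v)}_{j(k-l)},$$ and, for $0\le k\le\bar m_j-1$, $$\bar\gamma_{jk}^{(p,s)}=E_\infty\bar\gamma_{jk}^{(q,r)},\qquad \bar\gamma_{jk}^{(u,v)}=E_\infty\sum_{l=0}^k\binom kl\frac{d^l\sigma(\bar z_j)}{dz^l}\,\bar\gamma^{(q,r)}_{j(k-l)}.$$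
   Context: System (Q): $\begin{bmatrix}\alpha_n\\ \beta_n\end{bmatrix}=\begin{bmatrix} z & (z-z^{-1})q_n\\ z r_n & z^{-1}+(z-z^{-1})q_nr_n\end{bmatrix}\begin{bmatrix}\alpha_{n+1}\\ \beta_{n+1}\end{bmatrix}$; system (U) with potentials $(a,b)$: $\begin{bmatrix}\xi_n\\ \eta_n\end{bmatrix}=\begin{bmatrix} z & z a_n\\ z^{-1}b_n & z^{-1}\end{bmatrix}\begin{bmatrix}\xi_{n+1}\\ \eta_{n+1}\end{bmatrix}$. $D_n=\prod_{j\le n}(1-q_jr_j)$, $E_n=\prod_{j\le n}(1+q_jr_{j+1})$, $D_\infty,E_\infty$ the full products; $u_n=q_nE_{n-1}/D_n$, $v_n=(-r_n+r_{n+1}-q_nr_nr_{n+1})D_{n-1}/E_n$, $p_n=(q_n-q_{n+1}-q_nq_{n+1}r_{n+1})E_{n-1}/D_{n+1}$, $s_n=r_{n+1}D_n/E_n$. Superscripts $(q,r)$, $(u,v)$, $(p,s)$ refer to (Q) and to (U) with potentials $(u,v)$, $(p,s)$. For $|z|=1$ the Jost solutions (overbars not complex conjugation) are $\psi_n=\begin{bmatrix}o(1)\\ z^n[1+o(1)]\end{bmatrix}$, $\bar\psi_n=\begin{bmatrix}z^{-n}[1+o(1)]\\ o(1)\end{bmatrix}$ as $n\to+\infty$, and $\phi_n=\begin{bmatrix}z^{-n}[1+o(1)]\\ o(1)\end{bmatrix}$, $\bar\phi_n=\begin{bmatrix}o(1)\\ z^{n}[1+o(1)]\end{bmatrix}$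 as $n\to-\infty$; $\psi_n,\phi_n$ extend analytically in $z$ to $0<|z|<1$ and $\bar\psi_n,\bar\phi_n$ to $|z|>1$. Right transmission coefficients: first component of $\phi_n$ $=(1/T_{\rm r})z^{-n}[1+o(1)]$ and second component of $\bar\phi_n$ $=(1/\bar T_{\rm r})z^n[1+o(1)]$ as $n\to+\infty$ (for (Q), $T^{(q,r)}:=T_{\rm r}$, $\bar T^{(q,r)}:=\bar T_{\rm r}$), extended meromorphically to $|z|<1$, resp. $|z|>1$. Dependency constants: at a pole $z_j$ of multiplicity $m_j$, for each of the three systems there are unique constants $\gamma_{j0},\dots,\gamma_{j(m_j-1)}$ with $\frac{d^k\phi_n(z_j)}{dz^k}=\sum_{l=0}^k\binom kl\gamma_{j(k-l)}\frac{d^l\psi_n(z_j)}{dz^l}$ for all $n\in\mathbb Z$ and $0\le k\le m_j-1$; analogously $\bar\gamma_{jk}$ are defined at $\bar z_j$ by $\frac{d^k\bar\phi_n(\bar z_j)}{dz^k}=\sum_{l=0}^k\binom kl\bar\gamma_{j(k-l)}\frac{d^l\bar\psi_n(\bar z_j)}{dz^l}$, $0\le k\le\bar m_j-1$. *)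

theory Defs
  imports "HOL-Complex_Analysis.Complex_Analysis"
begin

definition rapid_decay :: "(int \<Rightarrow> complex) \<Rightarrow> bool" where
  "rapid_decay q \<longleftrightarrow> (\<forall>k::nat.
      ((\<lambda>n. (real_of_int \<bar>n\<bar>) ^ k * cmod (q n)) \<longlongrightarrow> 0) at_top \<and>
      ((\<lambda>n. (real_of_int \<bar>n\<bar>) ^ k * cmod (q n)) \<longlongrightarrow> 0) at_bot)"

definition Dn :: "(int \<Rightarrow> complex) \<Rightarrow> (int \<Rightarrow> complex) \<Rightarrow> int \<Rightarrow> complex" where
  "Dn q r n = lim (\<lambda>m::nat. \<Prod>j\<in>{n - int m..n}. (1 - q j * r j))"

definition En :: "(int \<Rightarrow> complex) \<Rightarrow> (int \<Rightarrow> complex) \<Rightarrow> int \<Rightarrow> complex" where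
  "En q r n = lim (\<lambda>m::nat. \<Prod>j\<in>{n - int m..n}. (1 + q j * r (j + 1)))"

definition Dinf :: "(int \<Rightarrow> complex) \<Rightarrow> (int \<Rightarrow> complex) \<Rightarrow> complex" where
  "Dinf q r = lim (\<lambda>m::nat. \<Prod>j\<in>{- int m..int m}. (1 - q j * r j))"

definition Einf :: "(int \<Rightarrow> complex) \<Rightarrow> (int \<Rightarrow> complex) \<Rightarrow> complex" where
  "Einf q r = lim (\<lambda>m::nat. \<Prod>j\<in>{- int m..int m}. (1 + q j * r (j + 1)))"

definition u_pot :: "(int \<Rightarrow> complex) \<Rightarrow> (int \<Rightarrow> complex) \<Rightarrow> int \<Rightarrow> complex" where
  "u_pot q r n = q n * En q r (n - 1) / Dn q r n"

definition v_pot :: "(int \<Rightarrow> complex) \<Rightarrow> (int \<Rightarrow> complex) \<Rightarrow> int \<Rightarrow> complex" where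
  "v_pot q r n = (- r n + r (n + 1) - q n * r n * r (n + 1)) * Dn q r (n - 1) / En q r n"

definition p_pot :: "(int \<Rightarrow> complex) \<Rightarrow> (int \<Rightarrow> complex) \<Rightarrow> int \<Rightarrow> complex" where
  "p_pot q r n = (q n - q (n + 1) - q n * q (n + 1) * r (n + 1)) * En q r (n - 1) / Dn q r (n + 1)"

definition s_pot :: "(int \<Rightarrow> complex) \<Rightarrow> (int \<Rightarrow> complex) \<Rightarrow> int \<Rightarrow> complex" where
  "s_pot q r n = r (n + 1) * Dn q r n / En q r n"

text \<open>A discrete system X n = A(z,n) X (n+1); the 2x2 matrix is stored as (a11, a12, a21, a22).\<close>
type_synonym sys = "complex \<Rightarrow> int \<Rightarrow> complex \<times> complex \<times> complex \<times> complex"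

definition Qsys :: "(int \<Rightarrow> complex) \<Rightarrow> (int \<Rightarrow> complex) \<Rightarrow> sys" where
  "Qsys q r z n = (z, (z - inverse z) * q n, z * r n, inverse z + (z - inverse z) * q n * r n)"

definition Usys :: "(int \<Rightarrow> complex) \<Rightarrow> (int \<Rightarrow> complex) \<Rightarrow> sys" where
  "Usys a b z n = (z, z * a n, inverse z * b n, inverse z)"

definition mat_app :: "complex \<times> complex \<times> complex \<times> complex \<Rightarrow> complex \<times> complex \<Rightarrow> complex \<times> complex" where
  "mat_app M X = (case M of (a, b, c, d) \<Rightarrow> (a * fst X + b * snd X, c * fst X + d * snd X))"

definition is_sol :: "sys \<Rightarrow> complex \<Rightarrow> (int \<Rightarrow> complex \<times> complex) \<Rightarrow> bool" where
  "is_sol M z X \<longleftrightarrow> (\<forall>n. X n = mat_app (M z n) (X (n + 1)))"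

text \<open>Analytic extension of each component (for each n) to region A, continuous up to the unit circle (B = A plus the circle).\<close>
definition ext_analytic :: "(complex \<Rightarrow> int \<Rightarrow> complex \<times> complex) \<Rightarrow> complex set \<Rightarrow> complex set \<Rightarrow> bool" where
  "ext_analytic f A B \<longleftrightarrow> (\<forall>n.
      (\<lambda>z. fst (f z n)) holomorphic_on A \<and> (\<lambda>z. snd (f z n)) holomorphic_on A \<and>
      continuous_on B (\<lambda>z. fst (f z n)) \<and> continuous_on B (\<lambda>z. snd (f z n)))"

abbreviation "inner_reg \<equiv> {z::complex. 0 < cmod z \<and> cmod z < 1}"
abbreviation "inner_cl \<equiv> {z::complex. 0 < cmod z \<and> cmod z \<le> 1}"
abbreviation "outer_reg \<equiv> {z::complex. 1 < cmod z}"
abbreviation "outer_cl \<equiv> {z::complex. 1 \<le> cmod z}"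

definition jost_psi :: "sys \<Rightarrow> (complex \<Rightarrow> int \<Rightarrow> complex \<times> complex) \<Rightarrow> bool" where
  "jost_psi M psi \<longleftrightarrow>
     (\<forall>z. cmod z = 1 \<longrightarrow> is_sol M z (psi z) \<and>
        (\<lambda>m::nat. fst (psi z (int m))) \<longlonglongrightarrow> 0 \<and>
        (\<lambda>m::nat. snd (psi z (int m)) / z powi (int m)) \<longlonglongrightarrow> 1) \<and>
     ext_analytic psi inner_reg inner_cl"

definition jost_psib :: "sys \<Rightarrow> (complex \<Rightarrow> int \<Rightarrow> complex \<times> complex) \<Rightarrow> bool" where
  "jost_psib M psib \<longleftrightarrow>
     (\<forall>z. cmod z = 1 \<longrightarrow> is_sol M z (psib z) \<and>
        (\<lambda>m::nat. fst (psib z (int m)) / z powi (- int m)) \<longlonglongrightarrow> 1 \<and>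
        (\<lambda>m::nat. snd (psib z (int m))) \<longlonglongrightarrow> 0) \<and>
     ext_analytic psib outer_reg outer_cl"

definition jost_phi :: "sys \<Rightarrow> (complex \<Rightarrow> int \<Rightarrow> complex \<times> complex) \<Rightarrow> bool" where
  "jost_phi M phi \<longleftrightarrow>
     (\<forall>z. cmod z = 1 \<longrightarrow> is_sol M z (phi z) \<and>
        (\<lambda>m::nat. fst (phi z (- int m)) / z powi (int m)) \<longlonglongrightarrow> 1 \<and>
        (\<lambda>m::nat. snd (phi z (- int m))) \<longlonglongrightarrow> 0) \<and>
     ext_analytic phi inner_reg inner_cl"

definition jost_phib :: "sys \<Rightarrow> (complex \<Rightarrow> int \<Rightarrow> complex \<times> complex) \<Rightarrow> bool" where
  "jost_phib M phib \<longleftrightarrow>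
     (\<forall>z. cmod z = 1 \<longrightarrow> is_sol M z (phib z) \<and>
        (\<lambda>m::nat. fst (phib z (- int m))) \<longlonglongrightarrow> 0 \<and>
        (\<lambda>m::nat. snd (phib z (- int m)) / z powi (- int m)) \<longlonglongrightarrow> 1) \<and>
     ext_analytic phib outer_reg outer_cl"

definition transm :: "(complex \<Rightarrow> int \<Rightarrow> complex \<times> complex) \<Rightarrow> (complex \<Rightarrow> complex) \<Rightarrow> bool" where
  "transm phi T \<longleftrightarrow>
     (\<forall>z. cmod z = 1 \<longrightarrow> (\<lambda>m::nat. fst (phi z (int m)) * z powi (int m)) \<longlonglongrightarrow> inverse (T z)) \<and>
     T meromorphic_on ball 0 1 \<and>
     (\<forall>w. cmod w = 1 \<longrightarrow> ((\<lambda>z. inverse (T z)) \<longlongrightarrow> inverse (T w)) (at w within ball 0 1))"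

definition transmb :: "(complex \<Rightarrow> int \<Rightarrow> complex \<times> complex) \<Rightarrow> (complex \<Rightarrow> complex) \<Rightarrow> bool" where
  "transmb phib Tb \<longleftrightarrow>
     (\<forall>z. cmod z = 1 \<longrightarrow> (\<lambda>m::nat. snd (phib z (int m)) * z powi (- int m)) \<longlonglongrightarrow> inverse (Tb z)) \<and>
     Tb meromorphic_on outer_reg \<and>
     (\<forall>w. cmod w = 1 \<longrightarrow> ((\<lambda>z. inverse (Tb z)) \<longlongrightarrow> inverse (Tb w)) (at w within outer_reg))"

definition jost_data :: "sys \<Rightarrow> (complex \<Rightarrow> int \<Rightarrow> complex \<times> complex) \<Rightarrow> (complex \<Rightarrow> int \<Rightarrow> complex \<times> complex)
    \<Rightarrow> (complex \<Rightarrow> int \<Rightarrow> complex \<times> complex) \<Rightarrow> (complex \<Rightarrow> int \<Rightarrow> complex \<times> complex)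
    \<Rightarrow> (complex \<Rightarrow> complex) \<Rightarrow> (complex \<Rightarrow> complex) \<Rightarrow> bool" where
  "jost_data M psi phi psib phib T Tb \<longleftrightarrow>
     jost_psi M psi \<and> jost_phi M phi \<and> jost_psib M psib \<and> jost_phib M phib \<and>
     transm phi T \<and> transmb phib Tb"

definition pole_mult :: "(complex \<Rightarrow> complex) \<Rightarrow> complex \<Rightarrow> nat \<Rightarrow> bool" where
  "pole_mult T z m \<longleftrightarrow> is_pole T z \<and> zorder T z = - int m"

definition dep_consts :: "(complex \<Rightarrow> int \<Rightarrow> complex \<times> complex) \<Rightarrow> (complex \<Rightarrow> int \<Rightarrow> complex \<times> complex)
    \<Rightarrow> complex \<Rightarrow> nat \<Rightarrow> (nat \<Rightarrow> complex) \<Rightarrow> bool" where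
  "dep_consts phi psi w m g \<longleftrightarrow> (\<forall>n. \<forall>k<m.
     (deriv ^^ k) (\<lambda>z. fst (phi z n)) w =
        (\<Sum>l\<le>k. of_nat (k choose l) * g (k - l) * (deriv ^^ l) (\<lambda>z. fst (psi z n)) w) \<and>
     (deriv ^^ k) (\<lambda>z. snd (phi z n)) w =
        (\<Sum>l\<le>k. of_nat (k choose l) * g (k - l) * (deriv ^^ l) (\<lambda>z. snd (psi z n)) w))"

definition sigma :: "complex \<Rightarrow> complex" where
  "sigma z = 1 / (1 - inverse (z ^ 2))"

end

theory Submission
  imports Defs
begin

text \<open>A gauge transformation with coefficients built from $D_n$, $E_n$ and $1 - z^{-2}$ maps solutions of
  (Q) to solutions of (U). Comparing asymptotics on the unit circle, where decaying solutions vanish,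
  and continuing analytically, the gauge transform of each Jost solution of (Q) is an explicit scalar
  multiple of the corresponding Jost solution of (U): the factors are 1, $D_\infty$, $1$, $E_\infty$
  for $\phi, \psi, \bar\phi, \bar\psi$ and $(p,s)$, and $1$, $(1 - z^{-2}) D_\infty$, $1 - z^{-2}$, $E_\infty$ for
  $(u,v)$. The dependency constants are the derivatives of any function $\Gamma$ for which $\phi_n - \Gamma \psi_n$
  vanishes to order $m$ for all $n$; such a $\Gamma$ is unique up to order $m$ since $\psi_n \neq 0$ for some $n$.
  The relations between the $\Gamma$ of different systems are read off from the scalar factors, and
  Leibniz' rule gives the sums over $l$.\<close>

section \<open>Analytic functions vanishing on the unit circle\<close>

text \<open>At z_j itself the given Jost solutions are known only as values of analytic extensions:
  neither the difference equation nor any behaviour in n is prescribed there. The non-vanishing of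
  psi at z_j therefore needs an explicitly constructed solution of (U), with which uniqueness
  identifies the given one. Construction and uniqueness are carried out for (U) alone, since (Q)
  enters only through its gauge transforms.

  As n tends to either end the gauge matrices become diagonal. A scalar factor is the limit of the
  diagonal entry belonging to the component and the end at which the Jost solution is normalised,
  which attaches D_inf to psi and E_inf to psib. The entry 1 - z^-2 falls on psi inside the circle
  but on phib outside. Writing Gamma_Q and Gamma_U for the two proportionality functions, one gets
  Gamma_U = (1 - z^-2) D_inf Gamma_Q inside and (1 - z^-2) Gamma_U = E_inf Gamma_Q outside. Hence
  sigma multiplies the constants of (u,v) in one formula and those of (Q) in the other.\<close>

text \<open>The puncture at 0 may be an essential singularity, so the maximum principle is not available;
  instead one reflects the pullback along $w \mapsto e^{i w}$ across the real line.\<close>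

lemma zero_on_unit_circle_imp_zero_inside:
  assumes holo: "f holomorphic_on inner_reg" and cont: "continuous_on inner_cl f"
    and zero: "\<And>z. cmod z = 1 \<Longrightarrow> f z = 0" and z: "z \<in> inner_reg"
  shows "f z = 0"
proof -
  define h where "h = (\<lambda>w. f (exp (\<i> * w)))"
  have hol: "h holomorphic_on (UNIV \<inter> {w. 0 < Im w})"
    unfolding h_def
    by (rule holomorphic_on_compose_gen[OF _ holo, unfolded o_def])
       (auto intro!: holomorphic_intros)
  have con: "continuous_on (UNIV \<inter> {w. 0 \<le> Im w}) h"
    unfolding h_def
    by (rule continuous_on_compose2[OF cont]) (auto intro!: continuous_intros)
  have re: "h w = 0" if "w \<in> \<real>" for w
    using that zero by (auto simp: h_def elim!: Reals_cases)
  have "(\<lambda>w. if 0 \<le> Im w then h w else cnj (h (cnj w))) holomorphic_on UNIV"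
    by (rule Schwarz_reflection) (use hol con re in auto)
  moreover have "(0::complex) islimpt \<real>"
  proof (rule islimpt_approachable[THEN iffD2], intro allI impI)
    fix e :: real assume "e > 0"
    then show "\<exists>x'\<in>\<real>. x' \<noteq> 0 \<and> dist x' (0::complex) < e"
      by (intro bexI[of _ "of_real (e / 2)"]) auto
  qed
  moreover have "(if 0 \<le> Im w then h w else cnj (h (cnj w))) = 0" if "w \<in> \<real>" for w
    using re[OF that] that by (simp add: complex_is_Real_iff)
  ultimately have H: "(if 0 \<le> Im w then h w else cnj (h (cnj w))) = 0" for w
    by (rule analytic_continuation[OF _ open_UNIV connected_UNIV subset_UNIV UNIV_I _ _ UNIV_I])
  have "z \<noteq> 0" "ln (cmod z) < 0"
    using z by auto
  then show ?thesis
    \<comment> \<open>This point is a preimage of z, and its imaginary part - ln |z| is positive, so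
      the unreflected branch applies.\<close>
    using H[of "- \<i> * Ln z"] by (simp add: h_def)
qed

text \<open>Inversion exchanges the two regions and maps the circle to itself; infinity takes the
  place of the puncture.\<close>

lemma zero_on_unit_circle_imp_zero_outside:
  assumes holo: "f holomorphic_on outer_reg" and cont: "continuous_on outer_cl f"
    and zero: "\<And>z. cmod z = 1 \<Longrightarrow> f z = 0" and z: "z \<in> outer_reg"
  shows "f z = 0"
proof -
  have "f (inverse (inverse z)) = 0"
  proof (rule zero_on_unit_circle_imp_zero_inside[where f = "\<lambda>w. f (inverse w)"])
    show "(\<lambda>w. f (inverse w)) holomorphic_on inner_reg"
      by (rule holomorphic_on_compose_gen[OF _ holo, unfolded o_def])
         (auto intro!: holomorphic_intros simp: norm_inverse one_less_inverse)
    show "continuous_on inner_cl (\<lambda>w. f (inverse w))"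
      by (rule continuous_on_compose2[OF cont])
         (auto intro!: continuous_intros simp: norm_inverse one_le_inverse)
    show "inverse z \<in> inner_reg"
      using z by (auto simp: norm_inverse inverse_less_1_iff)
  qed (use zero in \<open>auto simp: norm_inverse\<close>)
  then show ?thesis by simp
qed

section \<open>Functions vanishing to a given order\<close>

text \<open>For fixed m and w these germs form an ideal in the ring of germs analytic at w, so
  relations modulo order m can be added and multiplied. Analyticity is included because the rules
  for higher derivatives require it.\<close>

definition vanishes_to_order :: "nat \<Rightarrow> complex \<Rightarrow> (complex \<Rightarrow> complex) \<Rightarrow> bool" where
  "vanishes_to_order m w f \<longleftrightarrow> f analytic_on {w} \<and> (\<forall>k<m. (deriv ^^ k) f w = 0)"

lemma vanishes_to_order_add:
  assumes "vanishes_to_order m w f" "vanishes_to_order m w g"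
  shows "vanishes_to_order m w (\<lambda>z. f z + g z)"
  using assms by (auto simp: vanishes_to_order_def higher_deriv_add_at intro!: analytic_intros)

lemma vanishes_to_order_diff:
  assumes "vanishes_to_order m w f" "vanishes_to_order m w g"
  shows "vanishes_to_order m w (\<lambda>z. f z - g z)"
  using assms by (auto simp: vanishes_to_order_def higher_deriv_diff_at intro!: analytic_intros)

lemma vanishes_to_order_mult:
  assumes "vanishes_to_order m w f" "h analytic_on {w}"
  shows "vanishes_to_order m w (\<lambda>z. h z * f z)"
  using assms by (auto simp: vanishes_to_order_def higher_deriv_mult_at intro!: analytic_intros)

lemma vanishes_to_order_transform:
  assumes "vanishes_to_order m w f" "eventually (\<lambda>z. f z = g z) (nhds w)"
  shows "vanishes_to_order m w g"
  using assms analytic_at_cong[OF assms(2) refl] higher_deriv_cong_ev[OF assms(2) refl]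
  by (auto simp: vanishes_to_order_def)

lemma isCont_imp_eventually_nonzero:
  fixes h :: "complex \<Rightarrow> complex"
  assumes "isCont h w" "h w \<noteq> 0"
  shows "eventually (\<lambda>z. h z \<noteq> 0) (nhds w)"
  using assms by (simp add: continuous_within tendsto_imp_eventually_ne eventually_nhds_conv_at)

text \<open>A germ with nonzero value at w is a unit, so multiplication by its inverse removes the
  factor near w.\<close>

lemma vanishes_to_order_cancel:
  assumes v: "vanishes_to_order m w (\<lambda>z. h z * f z)"
    and h: "h analytic_on {w}" "h w \<noteq> 0"
  shows "vanishes_to_order m w f"
proof (rule vanishes_to_order_transform)
  show "vanishes_to_order m w (\<lambda>z. inverse (h z) * (h z * f z))"
    by (intro vanishes_to_order_mult v analytic_on_inverse h) (use h in auto)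
  have "eventually (\<lambda>z. h z \<noteq> 0) (nhds w)"
    by (intro isCont_imp_eventually_nonzero analytic_at_imp_isCont h)
  then show "eventually (\<lambda>z. inverse (h z) * (h z * f z) = f z) (nhds w)"
    by eventually_elim auto
qed

text \<open>The Taylor polynomial at w with derivatives \<open>g 0\<close>, ...,
  \<open>g (m - 1)\<close>; it serves as the function Gamma belonging to a list of dependency
  constants.\<close>

definition jet :: "nat \<Rightarrow> complex \<Rightarrow> (nat \<Rightarrow> complex) \<Rightarrow> complex \<Rightarrow> complex" where
  "jet m w g = (\<lambda>z. \<Sum>j<m. g j / fact j * (z - w) ^ j)"

lemma analytic_jet: "jet m w g analytic_on S"
  unfolding jet_def by (intro analytic_intros)

lemma higher_deriv_jet:
  "(deriv ^^ k) (jet m w g) w = (if k < m then g k else 0)"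
proof (induction m)
  case 0
  then show ?case by (simp add: jet_def)
next
  case (Suc m)
  have eq: "jet (Suc m) w g = (\<lambda>z. jet m w g z + g m / fact m * (z - w) ^ m)"
    by (simp add: jet_def)
  \<comment> \<open>At w the derivative vanishes for k < m through a positive power of 0, and for k
    > m through the Pochhammer factor, which then starts at 0.\<close>
  have "(deriv ^^ k) (\<lambda>z. g m / fact m * (z - w) ^ m) w = (if k = m then g m else 0)"
    by (subst higher_deriv_cmult')
       (auto simp: higher_deriv_power pochhammer_0_left pochhammer_fact[symmetric]
        power_0_left not_less intro!: analytic_intros)
  then show ?case
    unfolding eq
    by (subst higher_deriv_add_at) (auto simp: Suc.IH intro!: analytic_intros analytic_jet)
qed

text \<open>Leibniz' rule for Gamma times h. As k - l < m throughout, only prescribed derivatives of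
  Gamma occur, so the m defining relations of the constants become one congruence modulo order
  m.\<close>

lemma vanishes_to_order_diff_jet_iff:
  assumes "f analytic_on {w}" "h analytic_on {w}"
  shows "vanishes_to_order m w (\<lambda>z. f z - jet m w g z * h z) \<longleftrightarrow>
    (\<forall>k<m. (deriv ^^ k) f w = (\<Sum>l\<le>k. of_nat (k choose l) * g (k - l) * (deriv ^^ l) h w))"
proof -
  have "(deriv ^^ k) (\<lambda>z. f z - jet m w g z * h z) w =
      (deriv ^^ k) f w - (\<Sum>l\<le>k. of_nat (k choose l) * g (k - l) * (deriv ^^ l) h w)"
    if "k < m" for k
  proof -
    have "(deriv ^^ k) (\<lambda>z. h z * jet m w g z) w =
      (\<Sum>l\<le>k. of_nat (k choose l) * g (k - l) * (deriv ^^ l) h w)"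
      using that assms
      by (subst higher_deriv_mult_at)
         (auto simp: analytic_jet higher_deriv_jet atLeast0AtMost mult_ac intro!: sum.cong)
    then show ?thesis
      using assms
      by (subst higher_deriv_diff_at) (auto intro!: analytic_intros analytic_jet simp: mult.commute)
  qed
  moreover have "(\<lambda>z. f z - jet m w g z * h z) analytic_on {w}"
    by (intro analytic_intros analytic_jet assms)
  ultimately show ?thesis
    by (auto simp: vanishes_to_order_def)
qed

section \<open>Absolutely summable sequences and infinite products over the integers\<close>

abbreviation abs_summable :: "('i \<Rightarrow> 'a::real_normed_vector) \<Rightarrow> bool" where
  "abs_summable f \<equiv> (\<lambda>n. norm (f n)) summable_on UNIV"

text \<open>Links unconditional sums over Z, for which shifts are mere reindexings, with series over
  the naturals, to which the product and comparison criteria apply. The two half-lines overlap at 0,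
  which does not affect summability.\<close>

lemma abs_summable_int_iff:
  fixes f :: "int \<Rightarrow> 'a::real_normed_vector"
  shows "abs_summable f \<longleftrightarrow>
    summable (\<lambda>k. norm (f (int k))) \<and> summable (\<lambda>k. norm (f (- int k)))"
proof -
  have un: "(UNIV :: int set) = range int \<union> range (\<lambda>k. - int k)"
  proof (intro equalityI subsetI)
    fix n :: int
    show "n \<in> range int \<union> range (\<lambda>k. - int k)"
      by (cases n rule: int_cases2) auto
  qed auto
  have "abs_summable f \<longleftrightarrow> (\<lambda>n. norm (f n)) summable_on range int \<and> (\<lambda>n. norm (f n)) summable_on range (\<lambda>k. - int k)"
    unfolding un by (metis summable_on_union summable_on_subset_banach sup_ge1 sup_ge2)
  also have "(\<lambda>n. norm (f n)) summable_on range int \<longleftrightarrow> summable (\<lambda>k. norm (f (int k)))"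
    by (subst summable_on_reindex) (auto simp: o_def summable_on_UNIV_nonneg_real_iff)
  also have "(\<lambda>n. norm (f n)) summable_on range (\<lambda>k. - int k) \<longleftrightarrow> summable (\<lambda>k. norm (f (- int k)))"
    by (subst summable_on_reindex) (auto simp: o_def summable_on_UNIV_nonneg_real_iff inj_def)
  finally show ?thesis .
qed

lemma abs_summable_int_shift:
  fixes f :: "int \<Rightarrow> 'a::real_normed_vector"
  assumes "abs_summable f"
  shows "abs_summable (\<lambda>n. f (n + c))"
  using assms summable_on_reindex_bij_betw[of "\<lambda>n. n + c" UNIV UNIV "\<lambda>n. norm (f n)"]
  by (simp add: bij_plus_right)

lemma abs_summable_mult_bounded:
  fixes f g :: "'i \<Rightarrow> 'a::real_normed_field"
  assumes "abs_summable f" "\<And>n. norm (g n) \<le> C"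
  shows "abs_summable (\<lambda>n. f n * g n)"
proof (rule summable_on_comparison_test)
  show "(\<lambda>n. norm (f n) * C) summable_on UNIV"
    by (intro summable_on_cmult_left assms(1))
  show "norm (f n * g n) \<le> norm (f n) * C" for n
    by (simp add: norm_mult mult_left_mono assms)
qed simp

lemma abs_summable_imp_bounded:
  fixes f :: "'i \<Rightarrow> 'a::real_normed_vector"
  assumes "abs_summable f"
  shows "norm (f n) \<le> (\<Sum>\<^sub>\<infinity>n. norm (f n))"
  using finite_sum_le_infsum[OF assms, of "{n}"] by simp

lemma abs_summable_int_tendsto_0:
  fixes f :: "int \<Rightarrow> 'a::real_normed_vector"
  assumes f: "abs_summable f" and e: "e = 1 \<or> e = - 1"
  shows "(\<lambda>m. f (e * int m + c)) \<longlonglongrightarrow> 0"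
proof -
  have "summable (\<lambda>k. norm (f (e * int k + c)))"
    using abs_summable_int_shift[OF f, of c] e unfolding abs_summable_int_iff by auto
  then show ?thesis
    by (rule tendsto_norm_zero_cancel[OF summable_LIMSEQ_zero])
qed

text \<open>Decay with exponent 2 gives |q n| \<le> 1 / n^2 far out at each end, to be compared with
  the inverse squares.\<close>

lemma rapid_decay_imp_abs_summable:
  assumes "rapid_decay q"
  shows "abs_summable q"
proof -
  have "summable (\<lambda>k. norm (q (e * int k)))" if "e = 1 \<or> e = - 1" for e
  proof (rule summable_comparison_test_ev)
    have "filterlim (\<lambda>k. - int k) at_bot sequentially"
      unfolding filterlim_at_bot eventually_sequentially
    proof
      fix Z :: int
      show "\<exists>N. \<forall>k\<ge>N. - int k \<le> Z"
        by (rule exI[of _ "nat (- Z)"]) auto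
    qed
    then have "filterlim (\<lambda>k. e * int k) (if e = 1 then at_top else at_bot) sequentially"
      using that filterlim_int_sequentially by auto
    moreover have "((\<lambda>n. (real_of_int \<bar>n\<bar>) ^ 2 * cmod (q n)) \<longlongrightarrow> 0) (if e = 1 then at_top else at_bot)"
      using assms[unfolded rapid_decay_def, rule_format, of 2] by simp
    ultimately have "(\<lambda>k. (real_of_int \<bar>e * int k\<bar>) ^ 2 * cmod (q (e * int k))) \<longlonglongrightarrow> 0"
      by (rule filterlim_compose[rotated])
    then have "eventually (\<lambda>k. (real_of_int \<bar>e * int k\<bar>) ^ 2 * cmod (q (e * int k)) < 1) sequentially"
      by (rule order_tendstoD) simp
    then show "eventually (\<lambda>k. norm (norm (q (e * int k))) \<le> inverse (real k ^ 2)) sequentially"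
      using eventually_gt_at_top[of 0]
      by eventually_elim (use that in \<open>auto simp: field_simps abs_mult\<close>)
    show "summable (\<lambda>k. inverse (real k ^ 2))"
      by (rule inverse_power_summable) simp
  qed
  from this[of 1] this[of "-1"] show ?thesis
    by (simp add: abs_summable_int_iff)
qed

section \<open>Convergent products over the integers: the common form of D_n and E_n, and of D_inf
  and E_inf\<close>

definition left_prod :: "(int \<Rightarrow> complex) \<Rightarrow> int \<Rightarrow> complex" where
  "left_prod f n = lim (\<lambda>m::nat. \<Prod>j\<in>{n - int m..n}. f j)"

definition full_prod :: "(int \<Rightarrow> complex) \<Rightarrow> complex" where
  "full_prod f = lim (\<lambda>m::nat. \<Prod>j\<in>{- int m..int m}. f j)"

locale convergent_int_prod =
  fixes f :: "int \<Rightarrow> complex"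
  assumes summable: "abs_summable (\<lambda>n. f n - 1)"
    and nonzero: "f n \<noteq> 0"
begin

lemma summable_seq:
  assumes "e = 1 \<or> e = - 1"
  shows "summable (\<lambda>k. norm (f (e * int k + c) - 1))"
  using abs_summable_int_shift[OF summable, of c] assms unfolding abs_summable_int_iff by auto

text \<open>An absolutely convergent product without zero factors has a nonzero value. The sign e
  and the base point c cover both directions from any site.\<close>

lemma prod_tendsto_nonzero:
  assumes "e = 1 \<or> e = - 1"
  shows "\<exists>L. L \<noteq> 0 \<and> (\<lambda>m. \<Prod>i<m. f (e * int i + c)) \<longlonglongrightarrow> L"
proof -
  have "convergent_prod (\<lambda>k. f (e * int k + c))"
    by (intro abs_convergent_prod_imp_convergent_prod summable_imp_abs_convergent_prod
        summable_seq assms)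
  then show ?thesis
    using nonzero convergent_prod_LIMSEQ prodinf_nonzero by (metis LIMSEQ_lessThan_iff_atMost)
qed

lemma left_prod_tendsto: "(\<lambda>m. \<Prod>j\<in>{n - int m..n}. f j) \<longlonglongrightarrow> left_prod f n"
  and left_prod_nonzero: "left_prod f n \<noteq> 0"
proof -
  obtain L where L: "L \<noteq> 0" "(\<lambda>m. \<Prod>i<m. f (- 1 * int i + n)) \<longlonglongrightarrow> L"
    using prod_tendsto_nonzero[of "- 1" n] by blast
  \<comment> \<open>The window from n - m to n holds m + 1 factors, hence \<open>Suc m\<close> and
    the shifted limit below.\<close>
  have "(\<Prod>j\<in>{n - int m..n}. f j) = (\<Prod>i<Suc m. f (- 1 * int i + n))" for m
    by (rule prod.reindex_bij_witness[of _ "\<lambda>i. n - int i" "\<lambda>j. nat (n - j)"]) auto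
  then have "(\<lambda>m. \<Prod>j\<in>{n - int m..n}. f j) \<longlonglongrightarrow> L"
    using LIMSEQ_Suc[OF L(2)] by simp
  then show "(\<lambda>m. \<Prod>j\<in>{n - int m..n}. f j) \<longlonglongrightarrow> left_prod f n" "left_prod f n \<noteq> 0"
    using L(1) by (simp_all add: left_prod_def limI)
qed

lemma left_prod_rec: "left_prod f n = f n * left_prod f (n - 1)"
proof -
  have "(\<Prod>j\<in>{n - int (Suc m)..n}. f j) = f n * (\<Prod>j\<in>{n - 1 - int m..n - 1}. f j)" for m
  proof -
    have "{n - int (Suc m)..n} = insert n {n - 1 - int m..n - 1}"
      by auto
    then show ?thesis by simp
  qed
  then have "(\<lambda>m. f n * (\<Prod>j\<in>{n - 1 - int m..n - 1}. f j)) \<longlonglongrightarrow> left_prod f n"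
    using LIMSEQ_Suc[OF left_prod_tendsto[of n]] by simp
  moreover have "(\<lambda>m. f n * (\<Prod>j\<in>{n - 1 - int m..n - 1}. f j)) \<longlonglongrightarrow> f n * left_prod f (n - 1)"
    by (intro tendsto_intros left_prod_tendsto)
  ultimately show ?thesis
    by (rule LIMSEQ_unique)
qed

text \<open>The product ending at 0 splits into its top m factors and
  \<open>left_prod f (- m)\<close>. The top factors alone already tend to the full nonzero value, so
  the rest tends to 1.\<close>

lemma left_prod_tendsto_neg: "(\<lambda>m. left_prod f (- int m)) \<longlonglongrightarrow> 1"
proof -
  obtain L where L: "L \<noteq> 0" "(\<lambda>m. \<Prod>i<m. f (- 1 * int i + 0)) \<longlonglongrightarrow> L"
    using prod_tendsto_nonzero[of "- 1" 0] by blast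
  have split: "left_prod f 0 = (\<Prod>i<m. f (- 1 * int i + 0)) * left_prod f (- int m)" for m
  proof (induction m)
    case (Suc m)
    have "- int (Suc m) = - int m - 1"
      by simp
    then show ?case
      using Suc left_prod_rec[of "- int m"] by (simp only: prod.lessThan_Suc) simp
  qed simp
  have "(\<Prod>j\<in>{0 - int m..0}. f j) = (\<Prod>i<Suc m. f (- 1 * int i + 0))" for m
    by (rule prod.reindex_bij_witness[of _ "\<lambda>i. - int i" "\<lambda>j. nat (- j)"]) auto
  then have "L = left_prod f 0"
    using LIMSEQ_unique[OF LIMSEQ_Suc[OF L(2)]] left_prod_tendsto[of 0] by simp
  moreover have "(\<lambda>m. left_prod f 0 / (\<Prod>i<m. f (- 1 * int i + 0))) \<longlonglongrightarrow> left_prod f 0 / L"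
    by (intro tendsto_intros L)
  moreover have "left_prod f (- int m) = left_prod f 0 / (\<Prod>i<m. f (- 1 * int i + 0))" for m
    by (subst split[of m]) (simp add: nonzero)
  ultimately show ?thesis
    using L(1) by simp
qed

text \<open>Cut at 0, the left products and the symmetric windows of \<open>full_prod\<close> both
  tend to \<open>left_prod f 0\<close> times the product over the positive indices.\<close>

lemma left_prod_tendsto_pos: "(\<lambda>m. left_prod f (int m)) \<longlonglongrightarrow> full_prod f"
  and full_prod_nonzero: "full_prod f \<noteq> 0"
proof -
  obtain L where L: "L \<noteq> 0" "(\<lambda>m. \<Prod>i<m. f (1 * int i + 1)) \<longlonglongrightarrow> L"
    using prod_tendsto_nonzero[of 1 1] by blast
  have "left_prod f (int m) = left_prod f 0 * (\<Prod>i<m. f (1 * int i + 1))" for m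
  proof (induction m)
    case (Suc m)
    then show ?case
      using left_prod_rec[of "int m + 1"] by (simp add: mult_ac add_ac)
  qed simp
  moreover have "(\<lambda>m. left_prod f 0 * (\<Prod>i<m. f (1 * int i + 1))) \<longlonglongrightarrow> left_prod f 0 * L"
    by (intro tendsto_intros L)
  ultimately have 1: "(\<lambda>m. left_prod f (int m)) \<longlonglongrightarrow> left_prod f 0 * L"
    by simp
  have "(\<Prod>j\<in>{- int m..int m}. f j) = (\<Prod>j\<in>{0 - int m..0}. f j) * (\<Prod>i<m. f (1 * int i + 1))" for m
  proof -
    have "{- int m..int m} = {0 - int m..0} \<union> {1..int m}"
      by auto
    moreover have "(\<Prod>j\<in>{1..int m}. f j) = (\<Prod>i<m. f (1 * int i + 1))"
      by (rule prod.reindex_bij_witness[of _ "\<lambda>i. int i + 1" "\<lambda>j. nat (j - 1)"]) auto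
    ultimately show ?thesis
      by (simp add: prod.union_disjoint)
  qed
  moreover have "(\<lambda>m. (\<Prod>j\<in>{0 - int m..0}. f j) * (\<Prod>i<m. f (1 * int i + 1))) \<longlonglongrightarrow> left_prod f 0 * L"
    by (intro tendsto_intros left_prod_tendsto L)
  ultimately have "full_prod f = left_prod f 0 * L"
    by (simp add: full_prod_def limI)
  with 1 L left_prod_nonzero show "(\<lambda>m. left_prod f (int m)) \<longlonglongrightarrow> full_prod f" "full_prod f \<noteq> 0"
    by auto
qed

text \<open>A function on Z with limits along both half-lines is bounded; for the inverse the limits
  1 and \<open>full_prod f\<close> must be nonzero. Both bounds matter, as D and E occur in
  numerators and denominators of the potentials.\<close>

lemma left_prod_bounded: "\<exists>C. \<forall>n. cmod (left_prod f n) \<le> C"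
  and inverse_left_prod_bounded: "\<exists>C. \<forall>n. cmod (inverse (left_prod f n)) \<le> C"
proof -
  have bd: "\<exists>C. \<forall>n. cmod (g n) \<le> C"
    if g: "(\<lambda>m. g (int m)) \<longlonglongrightarrow> l" "(\<lambda>m. g (- int m)) \<longlonglongrightarrow> l'" for g :: "int \<Rightarrow> complex" and l l'
  proof -
    obtain C C' where "\<And>m. cmod (g (int m)) \<le> C" "\<And>m. cmod (g (- int m)) \<le> C'"
      using convergent_imp_Bseq[OF convergentI[OF g(1)]] convergent_imp_Bseq[OF convergentI[OF g(2)]]
      unfolding Bseq_def by blast
    then have "cmod (g n) \<le> max C C'" for n
      by (cases n rule: int_cases2) (auto simp: le_max_iff_disj)
    then show ?thesis by blast
  qed
  show "\<exists>C. \<forall>n. cmod (left_prod f n) \<le> C"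
    by (rule bd left_prod_tendsto_pos left_prod_tendsto_neg)+
  show "\<exists>C. \<forall>n. cmod (inverse (left_prod f n)) \<le> C"
    by (rule bd tendsto_inverse left_prod_tendsto_pos left_prod_tendsto_neg full_prod_nonzero one_neq_zero)+
qed

end

section \<open>Decaying solutions of (U) on the unit circle\<close>

text \<open>The l1 norm of a vector, invariant under diag(z, 1/z) on the unit circle.\<close>

definition amp :: "complex \<times> complex \<Rightarrow> real" where
  "amp X = cmod (fst X) + cmod (snd X)"

lemma amp_nonneg: "amp X \<ge> 0"
  by (simp add: amp_def)

lemma is_sol_Usys_iff:
  "is_sol (Usys a b) z X \<longleftrightarrow>
    (\<forall>n. fst (X n) = z * (fst (X (n + 1)) + a n * snd (X (n + 1))) \<and>
         snd (X n) = inverse z * (b n * fst (X (n + 1)) + snd (X (n + 1))))"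
  unfolding is_sol_def Usys_def mat_app_def by (simp add: prod_eq_iff algebra_simps)

lemma is_sol_Qsys_iff:
  "is_sol (Qsys q r) z X \<longleftrightarrow>
    (\<forall>n. fst (X n) = z * fst (X (n + 1)) + (z - inverse z) * q n * snd (X (n + 1)) \<and>
         snd (X n) = z * r n * fst (X (n + 1)) + (inverse z + (z - inverse z) * q n * r n) * snd (X (n + 1)))"
  unfolding is_sol_def Qsys_def mat_app_def by (simp add: prod_eq_iff)

text \<open>A backward Gronwall argument: \<open>x 0\<close> is at most exp of the total of
  \<epsilon> times \<open>x k\<close>, for every k.\<close>

lemma tendsto_0_imp_zero_if_growth:
  fixes x \<epsilon> :: "nat \<Rightarrow> real"
  assumes step: "\<And>k. x k \<le> exp (\<epsilon> k) * x (Suc k)" and "\<And>k. 0 \<le> x k" "\<And>k. 0 \<le> \<epsilon> k"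
    and sum: "summable \<epsilon>" and lim: "x \<longlonglongrightarrow> 0"
  shows "x 0 = 0"
proof -
  have "x 0 \<le> exp (\<Sum>i<k. \<epsilon> i) * x k" for k
  proof (induction k)
    case (Suc k)
    also have "exp (\<Sum>i<k. \<epsilon> i) * x k \<le> exp (\<Sum>i<k. \<epsilon> i) * (exp (\<epsilon> k) * x (Suc k))"
      by (intro mult_left_mono step) auto
    finally show ?case
      by (simp add: exp_add mult_ac)
  qed simp
  moreover have "exp (\<Sum>i<k. \<epsilon> i) * x k \<le> exp (suminf \<epsilon>) * x k" for k
    by (intro mult_right_mono) (auto intro!: sum_le_suminf sum assms)
  ultimately have le: "x 0 \<le> exp (suminf \<epsilon>) * x k" for k
    by (meson order_trans)
  have "(\<lambda>k. exp (suminf \<epsilon>) * x k) \<longlonglongrightarrow> exp (suminf \<epsilon>) * 0"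
    by (intro tendsto_intros lim)
  then have "x 0 \<le> exp (suminf \<epsilon>) * 0"
    using le by (meson LIMSEQ_le_const)
  then show ?thesis
    using assms(2)[of 0] by simp
qed

text \<open>The transfer matrix of (U) has determinant 1 - a n * b n. Running the system forward
  divides by it, so its inverse must be summably close to 1, as the matrix itself is to diag(z,
  1/z).\<close>

locale summable_potentials =
  fixes a b :: "int \<Rightarrow> complex"
  assumes a: "abs_summable a" and b: "abs_summable b"
    and det_nonzero: "1 - a n * b n \<noteq> 0"
    and det: "abs_summable (\<lambda>n. inverse (1 - a n * b n) - 1)"
begin

definition \<epsilon> :: "int \<Rightarrow> real" where
  "\<epsilon> n = cmod (a n) + cmod (b n) + cmod (inverse (1 - a n * b n) - 1)"

lemma \<epsilon>_nonneg: "0 \<le> \<epsilon> n"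
  by (simp add: \<epsilon>_def)

lemma \<epsilon>_summable: "abs_summable \<epsilon>"
proof -
  have "norm (\<epsilon> n) = cmod (a n) + cmod (b n) + cmod (inverse (1 - a n * b n) - 1)" for n
    by (simp add: \<epsilon>_def)
  then show ?thesis
    by (simp only:) (intro summable_on_add a b det)
qed

lemma \<epsilon>_summable_seq: "summable (\<lambda>k. \<epsilon> (int k + c))" "summable (\<lambda>k. \<epsilon> (- int k + c))"
  using abs_summable_int_shift[OF \<epsilon>_summable, of c] unfolding abs_summable_int_iff
  by (simp_all add: \<epsilon>_nonneg)

lemma perturbation_le: "cmod (x + a n * y) + cmod (b n * x + y) \<le> exp (\<epsilon> n) * (cmod x + cmod y)"
proof -
  have "cmod (x + a n * y) + cmod (b n * x + y) \<le>
      (cmod x + cmod (a n) * cmod y) + (cmod (b n) * cmod x + cmod y)"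
    by (intro add_mono norm_triangle_le) (auto simp: norm_mult)
  also have "\<dots> \<le> (1 + (cmod (a n) + cmod (b n))) * (cmod x + cmod y)"
    by (simp add: algebra_simps)
  also have "\<dots> \<le> exp (\<epsilon> n) * (cmod x + cmod y)"
    by (intro mult_right_mono order_trans[OF _ exp_ge_add_one_self]) (auto simp: \<epsilon>_def)
  finally show ?thesis .
qed

context
  fixes z X
  assumes z: "cmod z = 1" and sol: "is_sol (Usys a b) z X"
begin

lemma amp_backward: "amp (X n) \<le> exp (\<epsilon> n) * amp (X (n + 1))"
proof -
  have "amp (X n) = cmod (fst (X (n + 1)) + a n * snd (X (n + 1))) +
      cmod (b n * fst (X (n + 1)) + snd (X (n + 1)))"
    using sol[unfolded is_sol_Usys_iff, rule_format, of n] z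
    by (simp add: amp_def norm_mult norm_inverse)
  then show ?thesis
    using perturbation_le[of "fst (X (n + 1))" n "snd (X (n + 1))"] by (simp add: amp_def)
qed

lemma forward:
  "fst (X (n + 1)) = inverse (1 - a n * b n) * (inverse z * fst (X n) - a n * (z * snd (X n)))"
  "snd (X (n + 1)) = inverse (1 - a n * b n) * (z * snd (X n) - b n * (inverse z * fst (X n)))"
proof -
  have "z \<noteq> 0"
    using z by auto
  then have 1: "inverse z * fst (X n) = fst (X (n + 1)) + a n * snd (X (n + 1))"
    and 2: "z * snd (X n) = b n * fst (X (n + 1)) + snd (X (n + 1))"
    using sol[unfolded is_sol_Usys_iff, rule_format, of n] by simp_all
  show "fst (X (n + 1)) = inverse (1 - a n * b n) * (inverse z * fst (X n) - a n * (z * snd (X n)))"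
    "snd (X (n + 1)) = inverse (1 - a n * b n) * (z * snd (X n) - b n * (inverse z * fst (X n)))"
    unfolding 1 2
  proof -
    have "fst (X (n + 1)) + a n * snd (X (n + 1)) - a n * (b n * fst (X (n + 1)) + snd (X (n + 1))) =
        (1 - a n * b n) * fst (X (n + 1))"
      "b n * fst (X (n + 1)) + snd (X (n + 1)) - b n * (fst (X (n + 1)) + a n * snd (X (n + 1))) =
        (1 - a n * b n) * snd (X (n + 1))"
      by (simp_all add: algebra_simps)
    then show "fst (X (n + 1)) = inverse (1 - a n * b n) *
        (fst (X (n + 1)) + a n * snd (X (n + 1)) - a n * (b n * fst (X (n + 1)) + snd (X (n + 1))))"
      "snd (X (n + 1)) = inverse (1 - a n * b n) *
        (b n * fst (X (n + 1)) + snd (X (n + 1)) - b n * (fst (X (n + 1)) + a n * snd (X (n + 1))))"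
      using det_nonzero[of n] by simp_all
  qed
qed

text \<open>One factor exp (\<epsilon> n) pays for the inverse determinant, the other for the
  off-diagonal entries.\<close>

lemma amp_forward: "amp (X (n + 1)) \<le> exp (2 * \<epsilon> n) * amp (X n)"
proof -
  \<comment> \<open>The sign in y absorbs the entries -a n and -b n of the inverse matrix, so that
    \<open>perturbation_le\<close> applies unchanged.\<close>
  define c x y where "c = inverse (1 - a n * b n)" and "x = inverse z * fst (X n)" and "y = - (z * snd (X n))"
  have step: "fst (X (n + 1)) = c * (x + a n * y)" "snd (X (n + 1)) = - (c * (b n * x + y))"
    by (simp_all only: forward c_def x_def y_def minus_mult_right) simp_all
  have "cmod (fst (X (n + 1))) = cmod c * cmod (x + a n * y)"
    unfolding step by (rule norm_mult)
  moreover have "cmod (snd (X (n + 1))) = cmod c * cmod (b n * x + y)"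
    unfolding step norm_minus_cancel by (rule norm_mult)
  ultimately have "amp (X (n + 1)) = cmod c * (cmod (x + a n * y) + cmod (b n * x + y))"
    by (simp only: amp_def distrib_left)
  also have "\<dots> \<le> exp (\<epsilon> n) * (exp (\<epsilon> n) * (cmod x + cmod y))"
  proof (intro mult_mono perturbation_le)
    have "cmod c \<le> 1 + cmod (c - 1)"
      using norm_triangle_ineq[of 1 "c - 1"] by simp
    also have "\<dots> \<le> exp (cmod (c - 1))"
      by (rule exp_ge_add_one_self)
    also have "\<dots> \<le> exp (\<epsilon> n)"
      by (simp add: \<epsilon>_def c_def)
    finally show "cmod c \<le> exp (\<epsilon> n)" .
  qed auto
  also have "cmod x + cmod y = amp (X n)"
    using z by (simp add: x_def y_def amp_def norm_mult norm_inverse)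
  also have "exp (\<epsilon> n) * (exp (\<epsilon> n) * amp (X n)) = exp (2 * \<epsilon> n) * amp (X n)"
    by (simp only: mult_2 exp_add mult.assoc)
  finally show ?thesis .
qed

lemma zero_everywhere:
  assumes "X 0 = (0, 0)"
  shows "X n = (0, 0)"
proof (induction n rule: int_induct[where k = 0])
  case (step1 i)
  then show ?case
    using forward[of i] by (simp add: prod_eq_iff)
next
  case (step2 i)
  then show ?case
    using sol[unfolded is_sol_Usys_iff, rule_format, of "i - 1"] by (simp add: prod_eq_iff)
qed (rule assms)

text \<open>Decay at +\<infinity> is brought to site 0 by backward steps, decay at -\<infinity> by
  forward steps; the total amplification is finite in either direction.\<close>

lemma decaying_solution_zero:
  assumes e: "e = 1 \<or> e = - 1"
    and lim: "(\<lambda>m. fst (X (e * int m))) \<longlonglongrightarrow> 0" "(\<lambda>m. snd (X (e * int m))) \<longlonglongrightarrow> 0"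
  shows "X n = (0, 0)"
proof -
  have A: "(\<lambda>m. amp (X (e * int m))) \<longlonglongrightarrow> 0"
    unfolding amp_def using tendsto_add[OF lim[THEN tendsto_norm]] by simp
  have "amp (X 0) = 0"
    using e
  proof
    assume e: "e = 1"
    have "amp (X (int 0)) = 0"
    proof (rule tendsto_0_imp_zero_if_growth[where x = "\<lambda>k. amp (X (int k))"])
      show "amp (X (int k)) \<le> exp (\<epsilon> (int k + 0)) * amp (X (int (Suc k)))" for k
        using amp_backward[of "int k"] by (simp add: add.commute)
      show "summable (\<lambda>k. \<epsilon> (int k + 0))"
        by (rule \<epsilon>_summable_seq)
      show "(\<lambda>k. amp (X (int k))) \<longlonglongrightarrow> 0"
        using A e by simp
    qed (auto simp: amp_nonneg \<epsilon>_nonneg)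
    then show ?thesis by simp
  next
    assume e: "e = - 1"
    have "amp (X (- int 0)) = 0"
    proof (rule tendsto_0_imp_zero_if_growth[where x = "\<lambda>k. amp (X (- int k))"])
      \<comment> \<open>The step from -(k + 1) to -k involves the potentials at -(k + 1).\<close>
      show "amp (X (- int k)) \<le> exp (2 * \<epsilon> (- int k + - 1)) * amp (X (- int (Suc k)))" for k
      proof -
        have eq: "- int k + - 1 + 1 = - int k" "- int (Suc k) = - int k + - 1"
          by simp_all
        show ?thesis
          unfolding eq(2) using amp_forward[of "- int k + - 1", unfolded eq(1)] .
      qed
      show "summable (\<lambda>k. 2 * \<epsilon> (- int k + - 1))"
        by (intro summable_mult \<epsilon>_summable_seq)
      show "(\<lambda>k. amp (X (- int k))) \<longlonglongrightarrow> 0"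
        using A e by simp
    qed (auto simp: amp_nonneg \<epsilon>_nonneg)
    then show ?thesis by simp
  qed
  then have "X 0 = (0, 0)"
    by (simp add: amp_def add_nonneg_eq_0_iff prod_eq_iff)
  then show ?thesis
    by (rule zero_everywhere)
qed

end

end

section \<open>Jost solutions of (U)\<close>

text \<open>The sign e = 1 or e = -1 selects the end $n \to e \infty$ at which the asymptotics is prescribed.\<close>

definition jost_like :: "sys \<Rightarrow> int \<Rightarrow> (complex \<Rightarrow> complex) \<Rightarrow> (complex \<Rightarrow> complex) \<Rightarrow> (complex \<Rightarrow> nat \<Rightarrow> complex)
    \<Rightarrow> complex set \<Rightarrow> complex set \<Rightarrow> (complex \<Rightarrow> int \<Rightarrow> complex \<times> complex) \<Rightarrow> bool" where
  "jost_like M e c d w A B X \<longleftrightarrow>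
     (\<forall>z. cmod z = 1 \<longrightarrow> is_sol M z (X z) \<and>
        (\<lambda>m. fst (X z (e * int m)) - c z * w z m) \<longlonglongrightarrow> 0 \<and>
        (\<lambda>m. snd (X z (e * int m)) - d z * w z m) \<longlonglongrightarrow> 0) \<and>
     ext_analytic X A B"

text \<open>For |w m| = 1 quotient and difference asymptotics agree. The difference form is linear
  in the solution and also allows a zero leading coefficient.\<close>

lemma tendsto_diff_0_if_ratio:
  fixes f w :: "nat \<Rightarrow> complex"
  assumes "(\<lambda>m. f m / w m) \<longlonglongrightarrow> 1" "\<And>m. cmod (w m) = 1"
  shows "(\<lambda>m. f m - w m) \<longlonglongrightarrow> 0"
proof -
  have "w m \<noteq> 0" for m
    using assms(2)[of m] by auto
  then have "norm (f m / w m - 1) = norm (f m - w m)" for m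
    using assms(2)[of m] by (simp add: divide_simps norm_divide)
  moreover have "(\<lambda>m. norm (f m / w m - 1)) \<longlonglongrightarrow> 0"
    using assms(1) by (simp add: LIM_zero_iff tendsto_norm_zero_iff)
  ultimately show ?thesis
    by (simp add: tendsto_norm_zero_iff)
qed

lemma jost_psi_imp_jost_like:
  assumes "jost_psi M psi"
  shows "jost_like M 1 (\<lambda>_. 0) (\<lambda>_. 1) (\<lambda>z m. z powi int m) inner_reg inner_cl psi"
  using assms unfolding jost_psi_def jost_like_def
  by (auto intro!: tendsto_diff_0_if_ratio simp: norm_power_int norm_power)

lemma jost_psib_imp_jost_like:
  assumes "jost_psib M psib"
  shows "jost_like M 1 (\<lambda>_. 1) (\<lambda>_. 0) (\<lambda>z m. z powi (- int m)) outer_reg outer_cl psib"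
  using assms unfolding jost_psib_def jost_like_def
  by (auto intro!: tendsto_diff_0_if_ratio simp: norm_power_int norm_power)

lemma jost_phi_imp_jost_like:
  assumes "jost_phi M phi"
  shows "jost_like M (- 1) (\<lambda>_. 1) (\<lambda>_. 0) (\<lambda>z m. z powi int m) inner_reg inner_cl phi"
  using assms unfolding jost_phi_def jost_like_def
  by (auto intro!: tendsto_diff_0_if_ratio simp: norm_power_int norm_power)

lemma jost_phib_imp_jost_like:
  assumes "jost_phib M phib"
  shows "jost_like M (- 1) (\<lambda>_. 0) (\<lambda>_. 1) (\<lambda>z m. z powi (- int m)) outer_reg outer_cl phib"
  using assms unfolding jost_phib_def jost_like_def
  by (auto intro!: tendsto_diff_0_if_ratio simp: norm_power_int norm_power)

definition matched_regions :: "complex set \<Rightarrow> complex set \<Rightarrow> bool" where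
  "matched_regions A B \<longleftrightarrow> A = inner_reg \<and> B = inner_cl \<or> A = outer_reg \<and> B = outer_cl"

lemma zero_on_unit_circle_imp_zero:
  assumes "matched_regions A B" "f holomorphic_on A" "continuous_on B f"
    and "\<And>z. cmod z = 1 \<Longrightarrow> f z = 0" "z \<in> A"
  shows "f z = 0"
  using assms zero_on_unit_circle_imp_zero_inside zero_on_unit_circle_imp_zero_outside
  unfolding matched_regions_def by blast

context summable_potentials
begin

text \<open>On the circle X - h J solves (U) and decays at the end e, hence vanishes; each component
  then vanishes on A by continuation. The scalar h is kept as a multiplier instead of being divided
  out because it may have zeros on the circle, as 1 - z^-2 has at 1 and -1.\<close>

lemma jost_like_proportional:
  assumes e: "e = 1 \<or> e = - 1" and AB: "matched_regions A B"
    and J: "jost_like (Usys a b) e c d w A B J"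
    and X: "jost_like (Usys a b) e c' d' w A B X"
    and h: "h holomorphic_on A" "continuous_on B h"
    and cd: "\<And>z. c' z = h z * c z" "\<And>z. d' z = h z * d z"
    and z: "z \<in> A"
  shows "fst (X z n) = h z * fst (J z n)" "snd (X z n) = h z * snd (J z n)"
proof -
  define Y where "Y = (\<lambda>z n. (fst (X z n) - h z * fst (J z n), snd (X z n) - h z * snd (J z n)))"
  have circle: "Y z n = (0, 0)" if z: "cmod z = 1" for z n
  proof (rule decaying_solution_zero[OF z _ e])
    have "is_sol (Usys a b) z (J z)" "is_sol (Usys a b) z (X z)"
      using J X z by (auto simp: jost_like_def)
    note sol = this[unfolded is_sol_Usys_iff, rule_format]
    show "is_sol (Usys a b) z (Y z)"
      unfolding is_sol_Usys_iff
    proof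
      fix n
      show "fst (Y z n) = z * (fst (Y z (n + 1)) + a n * snd (Y z (n + 1))) \<and>
         snd (Y z n) = inverse z * (b n * fst (Y z (n + 1)) + snd (Y z (n + 1)))"
        using sol(1)[of n] sol(2)[of n] by (simp add: Y_def algebra_simps)
    qed
    have "(\<lambda>m. (fst (X z (e * int m)) - c' z * w z m) - h z * (fst (J z (e * int m)) - c z * w z m))
        \<longlonglongrightarrow> 0 - h z * 0"
      using J X z unfolding jost_like_def by (intro tendsto_intros) auto
    then show "(\<lambda>m. fst (Y z (e * int m))) \<longlonglongrightarrow> 0"
      by (simp add: Y_def cd algebra_simps)
    have "(\<lambda>m. (snd (X z (e * int m)) - d' z * w z m) - h z * (snd (J z (e * int m)) - d z * w z m))
        \<longlonglongrightarrow> 0 - h z * 0"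
      using J X z unfolding jost_like_def by (intro tendsto_intros) auto
    then show "(\<lambda>m. snd (Y z (e * int m))) \<longlonglongrightarrow> 0"
      by (simp add: Y_def cd algebra_simps)
  qed
  have hol: "(\<lambda>z. fst (X z n)) holomorphic_on A" "(\<lambda>z. snd (X z n)) holomorphic_on A"
      "(\<lambda>z. fst (J z n)) holomorphic_on A" "(\<lambda>z. snd (J z n)) holomorphic_on A"
    and con: "continuous_on B (\<lambda>z. fst (X z n))" "continuous_on B (\<lambda>z. snd (X z n))"
      "continuous_on B (\<lambda>z. fst (J z n))" "continuous_on B (\<lambda>z. snd (J z n))"
    using J X by (auto simp: jost_like_def ext_analytic_def)
  have "fst (Y z n) = 0"
    by (rule zero_on_unit_circle_imp_zero[OF AB _ _ _ z])
      (simp_all only: Y_def fst_conv circle[unfolded Y_def prod.inject]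
        holomorphic_on_diff holomorphic_on_mult continuous_on_diff continuous_on_mult hol con h)
  moreover have "snd (Y z n) = 0"
    by (rule zero_on_unit_circle_imp_zero[OF AB _ _ _ z])
      (simp_all only: Y_def snd_conv circle[unfolded Y_def prod.inject]
        holomorphic_on_diff holomorphic_on_mult continuous_on_diff continuous_on_mult hol con h)
  ultimately show "fst (X z n) = h z * fst (J z n)" "snd (X z n) = h z * snd (J z n)"
    by (simp_all add: Y_def)
qed

text \<open>With $\psi_n = z^n y_n$ the system becomes $y_n = diag(z^2, 1) (I + B_n) y_{n+1}$, whose partial
  products applied to $(0, 1)$ converge uniformly on the closed unit disc.\<close>

primrec jost_approx :: "nat \<Rightarrow> int \<Rightarrow> complex \<Rightarrow> complex \<times> complex" where
  "jost_approx 0 = (\<lambda>n z. (0, 1))"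
| "jost_approx (Suc k) = (\<lambda>n z.
     (z\<^sup>2 * (fst (jost_approx k (n + 1) z) + a n * snd (jost_approx k (n + 1) z)),
      b n * fst (jost_approx k (n + 1) z) + snd (jost_approx k (n + 1) z)))"

text \<open>\<open>jost_approx k n\<close> transports (0, 1) from site n + k back to n, so the
  increment transports the single defect (z^2 a, 0) created at n + k.\<close>

definition jost_incr :: "nat \<Rightarrow> int \<Rightarrow> complex \<Rightarrow> complex \<times> complex" where
  "jost_incr k n z = jost_approx (Suc k) n z - jost_approx k n z"

lemma jost_incr_Suc:
  "jost_incr (Suc k) n z =
    (z\<^sup>2 * (fst (jost_incr k (n + 1) z) + a n * snd (jost_incr k (n + 1) z)),
     b n * fst (jost_incr k (n + 1) z) + snd (jost_incr k (n + 1) z))"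
  unfolding jost_incr_def jost_approx.simps(2)[of "Suc k"] jost_approx.simps(2)[of k]
  by (simp add: prod_eq_iff algebra_simps)

text \<open>The defect has size at most \<epsilon> at n + k and passes through k matrices, each
  stretching by at most exp \<epsilon>. Since z enters only as z^2, the bound holds on the whole
  closed disc.\<close>

lemma amp_jost_incr_le_partial:
  assumes z: "cmod z \<le> 1"
  shows "amp (jost_incr k n z) \<le> exp (\<Sum>j<k. \<epsilon> (n + int j)) * \<epsilon> (n + int k)"
proof (induction k arbitrary: n)
  case 0
  have "cmod z ^ 2 * cmod (a n) \<le> 1 * cmod (a n)"
    using z by (intro mult_right_mono power_le_one) auto
  also have "1 * cmod (a n) \<le> \<epsilon> n"
    by (simp add: \<epsilon>_def)
  finally show ?case
    by (simp add: jost_incr_def amp_def norm_mult norm_power)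
next
  case (Suc k)
  define x y where "x = fst (jost_incr k (n + 1) z)" and "y = snd (jost_incr k (n + 1) z)"
  have "amp (jost_incr (Suc k) n z) = cmod z ^ 2 * cmod (x + a n * y) + cmod (b n * x + y)"
    by (simp add: jost_incr_Suc amp_def x_def y_def norm_mult norm_power)
  also have "\<dots> \<le> 1 * cmod (x + a n * y) + cmod (b n * x + y)"
    using z by (intro add_mono mult_right_mono power_le_one) auto
  also have "\<dots> \<le> exp (\<epsilon> n) * amp (jost_incr k (n + 1) z)"
    using perturbation_le[of x n y] by (simp add: amp_def x_def y_def)
  also have "\<dots> \<le> exp (\<epsilon> n) * (exp (\<Sum>j<k. \<epsilon> (n + 1 + int j)) * \<epsilon> (n + 1 + int k))"
    by (intro mult_left_mono Suc.IH) auto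
  also have "\<dots> = exp (\<Sum>j<Suc k. \<epsilon> (n + int j)) * \<epsilon> (n + int (Suc k))"
    unfolding sum.lessThan_Suc_shift by (simp add: exp_add add_ac)
  finally show ?case .
qed

lemma amp_jost_incr_le:
  assumes "cmod z \<le> 1"
  shows "amp (jost_incr k n z) \<le> exp (infsum \<epsilon> UNIV) * \<epsilon> (int k + n)"
proof -
  have "(\<Sum>j<k. \<epsilon> (n + int j)) = sum \<epsilon> ((\<lambda>j. n + int j) ` {..<k})"
    by (subst sum.reindex) (auto simp: inj_on_def)
  also have "\<dots> \<le> infsum \<epsilon> UNIV"
    using \<epsilon>_summable by (intro finite_sum_le_infsum) (auto simp: \<epsilon>_nonneg)
  finally have "exp (\<Sum>j<k. \<epsilon> (n + int j)) * \<epsilon> (n + int k) \<le> exp (infsum \<epsilon> UNIV) * \<epsilon> (n + int k)"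
    by (intro mult_right_mono) (auto simp: \<epsilon>_nonneg)
  then show ?thesis
    using amp_jost_incr_le_partial[OF assms, of k n] by (simp add: add.commute)
qed

lemma norm_jost_incr_le:
  assumes "cmod z \<le> 1"
  shows "cmod (fst (jost_incr k n z)) \<le> exp (infsum \<epsilon> UNIV) * \<epsilon> (int k + n)"
    and "cmod (snd (jost_incr k n z)) \<le> exp (infsum \<epsilon> UNIV) * \<epsilon> (int k + n)"
  using amp_jost_incr_le[OF assms, of k n] norm_ge_zero[of "fst (jost_incr k n z)"]
    norm_ge_zero[of "snd (jost_incr k n z)"] unfolding amp_def by linarith+

definition jost_lim :: "int \<Rightarrow> complex \<Rightarrow> complex \<times> complex" where
  "jost_lim n z = (\<Sum>k. fst (jost_incr k n z), 1 + (\<Sum>k. snd (jost_incr k n z)))"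

lemma uniform_limit_jost_lim:
  "uniform_limit (cball 0 1) (\<lambda>k z. fst (jost_approx k n z)) (\<lambda>z. fst (jost_lim n z)) sequentially"
  "uniform_limit (cball 0 1) (\<lambda>k z. snd (jost_approx k n z)) (\<lambda>z. snd (jost_lim n z)) sequentially"
proof -
  have sum: "summable (\<lambda>k. exp (infsum \<epsilon> UNIV) * \<epsilon> (int k + n))"
    by (intro summable_mult \<epsilon>_summable_seq)
  have telescope: "(\<Sum>i<k. fst (jost_incr i n z)) = fst (jost_approx k n z)"
    "1 + (\<Sum>i<k. snd (jost_incr i n z)) = snd (jost_approx k n z)" for k z
    using sum_lessThan_telescope[of "\<lambda>k. fst (jost_approx k n z)" k]
      sum_lessThan_telescope[of "\<lambda>k. snd (jost_approx k n z)" k]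
    by (simp_all add: jost_incr_def del: jost_approx.simps(2))
  have "uniform_limit (cball 0 1) (\<lambda>k z. \<Sum>i<k. fst (jost_incr i n z)) (\<lambda>z. \<Sum>k. fst (jost_incr k n z)) sequentially"
    by (rule Weierstrass_m_test[OF _ sum]) (simp add: norm_jost_incr_le)
  then show "uniform_limit (cball 0 1) (\<lambda>k z. fst (jost_approx k n z)) (\<lambda>z. fst (jost_lim n z)) sequentially"
    by (simp only: telescope jost_lim_def fst_conv)
  have "uniform_limit (cball 0 1) (\<lambda>k z. 1 + (\<Sum>i<k. snd (jost_incr i n z))) (\<lambda>z. 1 + (\<Sum>k. snd (jost_incr k n z))) sequentially"
    by (intro uniform_limit_add uniform_limit_const Weierstrass_m_test[OF _ sum]) (simp add: norm_jost_incr_le)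
  then show "uniform_limit (cball 0 1) (\<lambda>k z. snd (jost_approx k n z)) (\<lambda>z. snd (jost_lim n z)) sequentially"
    by (simp only: telescope jost_lim_def snd_conv)
qed

lemma jost_approx_holomorphic:
  "(\<lambda>z. fst (jost_approx k n z)) holomorphic_on S \<and> (\<lambda>z. snd (jost_approx k n z)) holomorphic_on S"
  by (induction k arbitrary: n) (auto intro!: holomorphic_intros)

lemma jost_lim_holomorphic:
  "(\<lambda>z. fst (jost_lim n z)) holomorphic_on ball 0 1" "continuous_on (cball 0 1) (\<lambda>z. fst (jost_lim n z))"
  "(\<lambda>z. snd (jost_lim n z)) holomorphic_on ball 0 1" "continuous_on (cball 0 1) (\<lambda>z. snd (jost_lim n z))"
proof -
  show "(\<lambda>z. fst (jost_lim n z)) holomorphic_on ball 0 1" "continuous_on (cball 0 1) (\<lambda>z. fst (jost_lim n z))"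
    by (rule holomorphic_uniform_limit[OF _ uniform_limit_jost_lim(1)[of n]];
        simp add: jost_approx_holomorphic holomorphic_on_imp_continuous_on)+
  show "(\<lambda>z. snd (jost_lim n z)) holomorphic_on ball 0 1" "continuous_on (cball 0 1) (\<lambda>z. snd (jost_lim n z))"
    by (rule holomorphic_uniform_limit[OF _ uniform_limit_jost_lim(2)[of n]];
        simp add: jost_approx_holomorphic holomorphic_on_imp_continuous_on)+
qed

lemma jost_lim_rec:
  assumes "cmod z \<le> 1"
  shows "fst (jost_lim n z) = z\<^sup>2 * (fst (jost_lim (n + 1) z) + a n * snd (jost_lim (n + 1) z))"
    and "snd (jost_lim n z) = b n * fst (jost_lim (n + 1) z) + snd (jost_lim (n + 1) z)"
proof -
  have lim: "(\<lambda>k. fst (jost_approx k n z)) \<longlonglongrightarrow> fst (jost_lim n z)"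
    "(\<lambda>k. snd (jost_approx k n z)) \<longlonglongrightarrow> snd (jost_lim n z)" for n
    using uniform_limit_jost_lim[of n] assms by (auto intro: tendsto_uniform_limitI)
  have "(\<lambda>k. fst (jost_approx (Suc k) n z)) \<longlonglongrightarrow>
      z\<^sup>2 * (fst (jost_lim (n + 1) z) + a n * snd (jost_lim (n + 1) z))"
    unfolding jost_approx.simps(2) fst_conv by (intro tendsto_intros lim)
  then show "fst (jost_lim n z) = z\<^sup>2 * (fst (jost_lim (n + 1) z) + a n * snd (jost_lim (n + 1) z))"
    by (rule LIMSEQ_unique[OF LIMSEQ_Suc[OF lim(1)]])
  have "(\<lambda>k. snd (jost_approx (Suc k) n z)) \<longlonglongrightarrow>
      b n * fst (jost_lim (n + 1) z) + snd (jost_lim (n + 1) z)"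
    unfolding jost_approx.simps(2) snd_conv by (intro tendsto_intros lim)
  then show "snd (jost_lim n z) = b n * fst (jost_lim (n + 1) z) + snd (jost_lim (n + 1) z)"
    by (rule LIMSEQ_unique[OF LIMSEQ_Suc[OF lim(2)]])
qed

text \<open>At site m the increments involve \<epsilon> only from m onwards, so the deviation from
  (0, 1) is bounded by a tail of a convergent series.\<close>

lemma jost_lim_tendsto:
  assumes "cmod z \<le> 1"
  shows "(\<lambda>m. fst (jost_lim (int m) z)) \<longlonglongrightarrow> 0" "(\<lambda>m. snd (jost_lim (int m) z)) \<longlonglongrightarrow> 1"
proof -
  define t where "t = (\<lambda>m. exp (infsum \<epsilon> UNIV) * (\<Sum>k. \<epsilon> (int (k + m) + 0)))"
  have "t \<longlonglongrightarrow> exp (infsum \<epsilon> UNIV) * 0"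
    unfolding t_def
    by (intro tendsto_intros suminf_exist_split2[where f = "\<lambda>k. \<epsilon> (int k + 0)"] \<epsilon>_summable_seq)
  then have t: "t \<longlonglongrightarrow> 0"
    by simp
  have le: "cmod (\<Sum>k. g k) \<le> t m"
    if g: "\<And>k. cmod (g k) \<le> exp (infsum \<epsilon> UNIV) * \<epsilon> (int k + int m)" for g :: "nat \<Rightarrow> complex" and m
  proof -
    have sum: "summable (\<lambda>k. exp (infsum \<epsilon> UNIV) * \<epsilon> (int k + int m))"
      by (intro summable_mult \<epsilon>_summable_seq)
    have "cmod (\<Sum>k. g k) \<le> (\<Sum>k. exp (infsum \<epsilon> UNIV) * \<epsilon> (int k + int m))"
      by (rule norm_suminf_le[OF g sum])
    also have "\<dots> = t m"
      unfolding t_def by (subst suminf_mult) (simp_all add: \<epsilon>_summable_seq)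
    finally show ?thesis .
  qed
  show "(\<lambda>m. fst (jost_lim (int m) z)) \<longlonglongrightarrow> 0"
    by (rule Lim_null_comparison[OF always_eventually t])
       (auto simp: jost_lim_def intro!: le norm_jost_incr_le assms)
  have "(\<lambda>m. snd (jost_lim (int m) z) - 1) \<longlonglongrightarrow> 0"
    by (rule Lim_null_comparison[OF always_eventually t])
       (auto simp: jost_lim_def intro!: le norm_jost_incr_le assms)
  then show "(\<lambda>m. snd (jost_lim (int m) z)) \<longlonglongrightarrow> 1"
    by (simp add: LIM_zero_iff)
qed

section \<open>The canonical psi and the non-vanishing of every psi\<close>

definition canonical_psi :: "complex \<Rightarrow> int \<Rightarrow> complex \<times> complex" where
  "canonical_psi z n = (z powi n * fst (jost_lim n z), z powi n * snd (jost_lim n z))"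

lemma jost_psi_canonical_psi: "jost_psi (Usys a b) canonical_psi"
  unfolding jost_psi_def
proof (intro conjI allI impI)
  fix z :: complex assume z: "cmod z = 1"
  then have nz: "z \<noteq> 0"
    by auto
  show "is_sol (Usys a b) z (canonical_psi z)"
    unfolding is_sol_Usys_iff
  proof
    fix n
    show "fst (canonical_psi z n) = z * (fst (canonical_psi z (n + 1)) + a n * snd (canonical_psi z (n + 1))) \<and>
      snd (canonical_psi z n) = inverse z * (b n * fst (canonical_psi z (n + 1)) + snd (canonical_psi z (n + 1)))"
      using nz z unfolding canonical_psi_def fst_conv snd_conv jost_lim_rec[of z n, OF eq_refl, OF z]
      by (simp add: power_int_add power2_eq_square field_simps)
  qed
  have "(\<lambda>m. fst (jost_lim (int m) z)) \<longlonglongrightarrow> 0"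
    using z by (intro jost_lim_tendsto) auto
  then have "(\<lambda>m. norm (fst (canonical_psi z (int m)))) \<longlonglongrightarrow> 0"
    using z by (simp add: canonical_psi_def norm_mult norm_power tendsto_norm_zero)
  then show "(\<lambda>m. fst (canonical_psi z (int m))) \<longlonglongrightarrow> 0"
    by (simp add: tendsto_norm_zero_iff)
  show "(\<lambda>m. snd (canonical_psi z (int m)) / z powi int m) \<longlonglongrightarrow> 1"
    using jost_lim_tendsto(2)[of z] z nz by (simp add: canonical_psi_def)
next
  have sub: "inner_reg \<subseteq> ball 0 1" "inner_cl \<subseteq> cball 0 1"
    by auto
  show "ext_analytic canonical_psi inner_reg inner_cl"
    unfolding ext_analytic_def canonical_psi_def fst_conv snd_conv
    by (intro allI conjI holomorphic_on_mult continuous_on_mult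
        holomorphic_on_subset[OF jost_lim_holomorphic(1) sub(1)]
        holomorphic_on_subset[OF jost_lim_holomorphic(3) sub(1)]
        continuous_on_subset[OF jost_lim_holomorphic(2) sub(2)]
        continuous_on_subset[OF jost_lim_holomorphic(4) sub(2)])
      (auto intro!: holomorphic_intros continuous_intros)
qed

text \<open>Uniqueness identifies psi with the canonical solution, whose second component divided by
  z^n tends to 1 even for 0 < |z| < 1.\<close>

lemma jost_psi_nonzero:
  assumes psi: "jost_psi (Usys a b) psi" and z: "z \<in> inner_reg"
  shows "\<exists>n. snd (psi z n) \<noteq> 0"
proof (rule ccontr)
  assume "\<not> ?thesis"
  then have zero: "snd (psi z n) = 0" for n
    by blast
  have "snd (canonical_psi z n) = 1 * snd (psi z n)" for n
    by (rule jost_like_proportional(2)[where h = "\<lambda>_. 1", OF _ _ jost_psi_imp_jost_like[OF psi]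
          jost_psi_imp_jost_like[OF jost_psi_canonical_psi] _ _ _ _ z])
       (simp_all add: matched_regions_def)
  then have "snd (jost_lim n z) = 0" for n
    using zero z by (auto simp: canonical_psi_def)
  moreover have "(\<lambda>m. snd (jost_lim (int m) z)) \<longlonglongrightarrow> 1"
    using z by (intro jost_lim_tendsto) auto
  ultimately show False
    by (simp add: LIMSEQ_const_iff)
qed

end

text \<open>Swapping components and inverting $z$ exchanges the potentials and turns $\bar\psi$ into $\psi$.\<close>

lemma (in summable_potentials) jost_psib_nonzero:
  assumes psib: "jost_psib (Usys a b) psib" and z: "z \<in> outer_reg"
  shows "\<exists>n. fst (psib z n) \<noteq> 0"
proof -
  interpret swap: summable_potentials b a
    by unfold_locales (use a b det det_nonzero in \<open>simp_all add: mult.commute\<close>)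
  define psi where "psi = (\<lambda>w n. (snd (psib (inverse w) n), fst (psib (inverse w) n)))"
  have "jost_psi (Usys b a) psi"
    unfolding jost_psi_def
  proof (intro conjI allI impI)
    fix w :: complex assume w: "cmod w = 1"
    then have iw: "cmod (inverse w) = 1"
      by (simp add: norm_inverse)
    note * = psib[unfolded jost_psib_def, THEN conjunct1, rule_format, OF iw]
    show "is_sol (Usys b a) w (psi w)"
      unfolding is_sol_Usys_iff
    proof
      fix n
      show "fst (psi w n) = w * (fst (psi w (n + 1)) + b n * snd (psi w (n + 1))) \<and>
          snd (psi w n) = inverse w * (a n * fst (psi w (n + 1)) + snd (psi w (n + 1)))"
        using *[THEN conjunct1, unfolded is_sol_Usys_iff, rule_format, of n]
        by (simp add: psi_def add.commute)
    qed
    show "(\<lambda>m. fst (psi w (int m))) \<longlonglongrightarrow> 0"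
      using *[THEN conjunct2] by (simp add: psi_def)
    show "(\<lambda>m. snd (psi w (int m)) / w powi int m) \<longlonglongrightarrow> 1"
      using *[THEN conjunct2] by (simp add: psi_def power_int_minus power_inverse)
  next
    have ext: "ext_analytic psib outer_reg outer_cl"
      using psib by (simp add: jost_psib_def)
    have H: "(\<lambda>w. f (inverse w)) holomorphic_on inner_reg" if "f holomorphic_on outer_reg" for f
      by (rule holomorphic_on_compose_gen[OF _ that, unfolded o_def])
         (auto intro!: holomorphic_intros simp: norm_inverse one_less_inverse)
    have K: "continuous_on inner_cl (\<lambda>w. f (inverse w))" if "continuous_on outer_cl f" for f :: "complex \<Rightarrow> complex"
      by (rule continuous_on_compose2[OF that])
         (auto intro!: continuous_intros simp: norm_inverse one_le_inverse)
    show "ext_analytic psi inner_reg inner_cl"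
      unfolding ext_analytic_def psi_def fst_conv snd_conv
    proof
      fix n
      show "(\<lambda>z. snd (psib (inverse z) n)) holomorphic_on inner_reg \<and>
          (\<lambda>z. fst (psib (inverse z) n)) holomorphic_on inner_reg \<and>
          continuous_on inner_cl (\<lambda>z. snd (psib (inverse z) n)) \<and>
          continuous_on inner_cl (\<lambda>z. fst (psib (inverse z) n))"
        using ext[unfolded ext_analytic_def, rule_format, of n] H[of "\<lambda>z. snd (psib z n)"]
          H[of "\<lambda>z. fst (psib z n)"] K[of "\<lambda>z. snd (psib z n)"] K[of "\<lambda>z. fst (psib z n)"]
        by blast
    qed
  qed
  moreover have "inverse z \<in> inner_reg"
    using z by (auto simp: norm_inverse inverse_less_1_iff)
  ultimately show ?thesis
    using swap.jost_psi_nonzero[of psi "inverse z"] by (simp add: psi_def)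
qed

section \<open>Gauge transformations from (Q) to (U)\<close>

lemma Dn_eq: "Dn q r = left_prod (\<lambda>j. 1 - q j * r j)"
  by (simp add: Dn_def left_prod_def fun_eq_iff)

lemma En_eq: "En q r = left_prod (\<lambda>j. 1 + q j * r (j + 1))"
  by (simp add: En_def left_prod_def fun_eq_iff)

lemma Dinf_eq: "Dinf q r = full_prod (\<lambda>j. 1 - q j * r j)"
  by (simp add: Dinf_def full_prod_def)

lemma Einf_eq: "Einf q r = full_prod (\<lambda>j. 1 + q j * r (j + 1))"
  by (simp add: Einf_def full_prod_def)

lemma abs_summable_add:
  assumes "abs_summable f" "abs_summable g"
  shows "abs_summable (\<lambda>n. f n + g n)"
proof (rule summable_on_comparison_test)
  show "(\<lambda>n. norm (f n) + norm (g n)) summable_on UNIV"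
    by (intro summable_on_add assms)
qed (auto intro: norm_triangle_ineq)

lemma abs_summable_minus:
  assumes "abs_summable f"
  shows "abs_summable (\<lambda>n. - f n)"
  using assms by simp

lemma abs_summable_mult:
  fixes f g :: "'i \<Rightarrow> 'a::real_normed_field"
  assumes "abs_summable f" "abs_summable g"
  shows "abs_summable (\<lambda>n. f n * g n)"
  using abs_summable_mult_bounded[OF assms(1) abs_summable_imp_bounded[OF assms(2)]] .

section \<open>The potentials (u,v) and (p,s): summability and determinants\<close>

locale Q_potentials =
  fixes q r :: "int \<Rightarrow> complex"
  assumes q: "abs_summable q" and r: "abs_summable r"
    and D_factor: "1 - q n * r n \<noteq> 0" and E_factor: "1 + q n * r (n + 1) \<noteq> 0"
begin

abbreviation "D \<equiv> Dn q r"
abbreviation "E \<equiv> En q r"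
abbreviation "u \<equiv> u_pot q r"
abbreviation "v \<equiv> v_pot q r"
abbreviation "p \<equiv> p_pot q r"
abbreviation "s \<equiv> s_pot q r"

lemma r_Suc: "abs_summable (\<lambda>n. r (n + 1))" and q_Suc: "abs_summable (\<lambda>n. q (n + 1))"
  by (intro abs_summable_int_shift q r)+

sublocale Dp: convergent_int_prod "\<lambda>j. 1 - q j * r j"
proof
  have "abs_summable (\<lambda>n. - (q n * r n))"
    by (intro abs_summable_minus abs_summable_mult q r)
  then show "abs_summable (\<lambda>n. 1 - q n * r n - 1)"
    by simp
qed (rule D_factor)

sublocale Ep: convergent_int_prod "\<lambda>j. 1 + q j * r (j + 1)"
proof
  have "abs_summable (\<lambda>n. q n * r (n + 1))"
    by (intro abs_summable_mult q r_Suc)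
  then show "abs_summable (\<lambda>n. 1 + q n * r (n + 1) - 1)"
    by simp
qed (rule E_factor)

lemma D_nonzero: "D n \<noteq> 0" and E_nonzero: "E n \<noteq> 0"
  by (simp_all add: Dn_eq En_eq Dp.left_prod_nonzero Ep.left_prod_nonzero)

lemma D_rec: "D n = (1 - q n * r n) * D (n - 1)" and E_rec: "E n = (1 + q n * r (n + 1)) * E (n - 1)"
  unfolding Dn_eq En_eq by (rule Dp.left_prod_rec Ep.left_prod_rec)+

lemma D_Suc: "D (n + 1) = (1 - q (n + 1) * r (n + 1)) * D n"
  using D_rec[of "n + 1"] by simp

text \<open>These are the quotients that multiply expressions in q and r in the four potentials,
  which thereby inherit summability.\<close>

lemma quotients_bounded:
  "\<exists>C. \<forall>n. cmod (E (n - 1) * inverse (D n)) \<le> C"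
  "\<exists>C. \<forall>n. cmod (E (n - 1) * inverse (D (n + 1))) \<le> C"
  "\<exists>C. \<forall>n. cmod (D (n - 1) * inverse (E n)) \<le> C"
  "\<exists>C. \<forall>n. cmod (D n * inverse (E n)) \<le> C"
proof -
  have bd: "\<exists>C. \<forall>n. cmod (f n * g n) \<le> C"
    if "\<And>n. cmod (f n) \<le> C" "\<And>n. cmod (g n) \<le> C'" for f g :: "int \<Rightarrow> complex" and C C'
  proof -
    have "0 \<le> C"
      using that(1)[of 0] norm_ge_zero[of "f 0"] by linarith
    then have "cmod (f n * g n) \<le> C * C'" for n
      by (simp only: norm_mult) (intro mult_mono that norm_ge_zero)
    then show ?thesis
      by blast
  qed
  obtain CD CD' where D: "\<And>n. cmod (D n) \<le> CD" "\<And>n. cmod (inverse (D n)) \<le> CD'"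
    using Dp.left_prod_bounded Dp.inverse_left_prod_bounded unfolding Dn_eq by blast
  obtain CE CE' where E: "\<And>n. cmod (E n) \<le> CE" "\<And>n. cmod (inverse (E n)) \<le> CE'"
    using Ep.left_prod_bounded Ep.inverse_left_prod_bounded unfolding En_eq by blast
  note C = D E
  show "\<exists>C. \<forall>n. cmod (E (n - 1) * inverse (D n)) \<le> C"
    by (rule bd) (rule C)+
  show "\<exists>C. \<forall>n. cmod (E (n - 1) * inverse (D (n + 1))) \<le> C"
    by (rule bd) (rule C)+
  show "\<exists>C. \<forall>n. cmod (D (n - 1) * inverse (E n)) \<le> C"
    by (rule bd) (rule C)+
  show "\<exists>C. \<forall>n. cmod (D n * inverse (E n)) \<le> C"
    by (rule bd) (rule C)+
qed

lemma abs_summable_u: "abs_summable u"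
proof -
  obtain C where "\<And>n. cmod (E (n - 1) * inverse (D n)) \<le> C"
    using quotients_bounded by blast
  from abs_summable_mult_bounded[OF q this] show ?thesis
    by (simp add: u_pot_def field_class.field_divide_inverse mult.assoc)
qed

lemma abs_summable_v: "abs_summable v"
proof -
  obtain C where C: "\<And>n. cmod (D (n - 1) * inverse (E n)) \<le> C"
    using quotients_bounded by blast
  have "abs_summable (\<lambda>n. - r n + r (n + 1) + - (q n * r n * r (n + 1)))"
    by (intro abs_summable_add abs_summable_minus abs_summable_mult q r r_Suc)
  from abs_summable_mult_bounded[OF this C] show ?thesis
    by (simp add: v_pot_def field_class.field_divide_inverse mult.assoc)
qed

lemma abs_summable_p: "abs_summable p"
proof -
  obtain C where C: "\<And>n. cmod (E (n - 1) * inverse (D (n + 1))) \<le> C"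
    using quotients_bounded by blast
  have "abs_summable (\<lambda>n. q n + - q (n + 1) + - (q n * q (n + 1) * r (n + 1)))"
    by (intro abs_summable_add abs_summable_minus abs_summable_mult q q_Suc r_Suc)
  from abs_summable_mult_bounded[OF this C] show ?thesis
    by (simp add: p_pot_def field_class.field_divide_inverse mult.assoc)
qed

lemma abs_summable_s: "abs_summable s"
proof -
  obtain C where "\<And>n. cmod (D n * inverse (E n)) \<le> C"
    using quotients_bounded by blast
  from abs_summable_mult_bounded[OF r_Suc this] show ?thesis
    by (simp add: s_pot_def field_class.field_divide_inverse mult.assoc)
qed

text \<open>The matrix of (Q) has determinant 1, so the determinant of (U) is a quotient of gauge
  determinants at n and n + 1. These are (1 - z^-2) E (n - 1) D (n - 1) here and E (n - 1) D n in
  \<open>det_p_s\<close>. The product form yields non-vanishing and the inverse at once.\<close>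

lemma det_u_v: "(1 - u n * v n) * ((1 - q n * r n) * (1 + q n * r (n + 1))) = 1"
proof -
  define x y where "x = 1 - q n * r n" and "y = 1 + q n * r (n + 1)"
  have nz: "x \<noteq> 0" "y \<noteq> 0" "D (n - 1) \<noteq> 0" "E (n - 1) \<noteq> 0"
    using D_factor E_factor D_nonzero E_nonzero by (auto simp: x_def y_def)
  have "u n * v n * (x * y) = q n * (- r n + r (n + 1) - q n * r n * r (n + 1))"
    using nz unfolding u_pot_def v_pot_def D_rec[of n] E_rec[of n] x_def[symmetric] y_def[symmetric]
    by (simp add: field_simps)
  also have "\<dots> = x * y - 1"
    by (simp add: x_def y_def algebra_simps)
  finally show ?thesis
    by (simp add: left_diff_distrib flip: x_def y_def)
qed

lemma det_p_s: "(1 - p n * s n) * ((1 - q (n + 1) * r (n + 1)) * (1 + q n * r (n + 1))) = 1"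
proof -
  define x y where "x = 1 - q (n + 1) * r (n + 1)" and "y = 1 + q n * r (n + 1)"
  have nz: "x \<noteq> 0" "y \<noteq> 0" "D n \<noteq> 0" "E (n - 1) \<noteq> 0"
    using D_factor[of "n + 1"] E_factor D_nonzero E_nonzero by (auto simp: x_def y_def)
  have "p n * s n * (x * y) = (q n - q (n + 1) - q n * q (n + 1) * r (n + 1)) * r (n + 1)"
    using nz unfolding p_pot_def s_pot_def D_Suc[of n] E_rec[of n] x_def[symmetric] y_def[symmetric]
    by (simp add: field_simps)
  also have "\<dots> = x * y - 1"
    by (simp add: x_def y_def algebra_simps)
  finally show ?thesis
    by (simp add: left_diff_distrib flip: x_def y_def)
qed

lemma det_inverse_summable:
  assumes "\<And>n. (1 - a n * b n) * ((1 - f n) * (1 + g n)) = (1::complex)"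
    and f: "abs_summable f" and g: "abs_summable g"
  shows "abs_summable (\<lambda>n. inverse (1 - a n * b n) - 1)"
proof -
  have "inverse (1 - a n * b n) - 1 = - f n + g n + - (f n * g n)" for n
    using inverse_unique[OF assms(1)[of n]] by (simp add: algebra_simps)
  then show ?thesis
    by (simp only:) (intro abs_summable_add abs_summable_minus abs_summable_mult f g)
qed

sublocale UV: summable_potentials u v
proof
  show "1 - u n * v n \<noteq> 0" for n
    using det_u_v[of n] by force
  show "abs_summable (\<lambda>n. inverse (1 - u n * v n) - 1)"
    by (rule det_inverse_summable[OF det_u_v]) (intro abs_summable_mult q r r_Suc)+
qed (rule abs_summable_u abs_summable_v)+

sublocale PS: summable_potentials p s
proof
  show "1 - p n * s n \<noteq> 0" for n
    using det_p_s[of n] by force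
  show "abs_summable (\<lambda>n. inverse (1 - p n * s n) - 1)"
    by (rule det_inverse_summable[OF det_p_s]) (intro abs_summable_mult q q_Suc r_Suc)+
qed (rule abs_summable_p abs_summable_s)+

text \<open>The transfer matrix of (Q) factors as $L(r_n) R(-q_n) Z R(q_n)$ with $Z = diag(z, z^{-1})$ and
  $L(r)$, $R(q)$ lower and upper unipotent. Permuting these factors cyclically and normalising the
  diagonal entries by $E$ and $D$ turns it into a transfer matrix of (U). For $(u,v)$ one conjugates by
  $diag(1 - z^{-2}, 1)$ first; the gauge below is the result multiplied by $1 - z^{-2}$, so that it
  stays regular at $z = 1$ and $z = -1$.\<close>

definition gaugeP :: "(complex \<Rightarrow> int \<Rightarrow> complex \<times> complex) \<Rightarrow> complex \<Rightarrow> int \<Rightarrow> complex \<times> complex" where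
  "gaugeP X z n =
    (E (n - 1) * ((1 - q n * r n) * fst (X z n) + q n * snd (X z n)),
     D n * (snd (X z n) - r n * fst (X z n)))"

definition gaugeU :: "(complex \<Rightarrow> int \<Rightarrow> complex \<times> complex) \<Rightarrow> complex \<Rightarrow> int \<Rightarrow> complex \<times> complex" where
  "gaugeU X z n =
    (E (n - 1) * fst (X z n),
     D (n - 1) * ((1 - inverse (z\<^sup>2)) * snd (X z n) - r n * fst (X z n)))"

text \<open>With R(q_n) L(-r_n) X_n as new unknown, the step becomes Z times R(q_n) L(r_{n+1})
  R(-q_{n+1}). The off-diagonal entries of this z-free product are the numerators of p_n and s_n
  without D and E; its diagonal entries are g and h below, which the normalisation by E and D turns
  into 1.\<close>

lemma is_sol_gaugeP:
  assumes z: "z \<noteq> 0" and sol: "is_sol (Qsys q r) z (X z)"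
  shows "is_sol (Usys p s) z (gaugeP X z)"
  unfolding is_sol_Usys_iff
proof
  fix n
  define x y x' y' where "x = fst (X z n)" "y = snd (X z n)" "x' = fst (X z (n + 1))" "y' = snd (X z (n + 1))"
  note xy = this
  have 1: "x = z * x' + (z - inverse z) * q n * y'"
    and 2: "y = z * r n * x' + (inverse z + (z - inverse z) * q n * r n) * y'"
    using sol[unfolded is_sol_Qsys_iff, rule_format, of n] by (simp_all only: xy)
  \<comment> \<open>In matrix form R(q_n) L(-r_n) X_n = Z R(q_n) X_{n+1}.\<close>
  have half: "(1 - q n * r n) * x + q n * y = z * (x' + q n * y')" "y - r n * x = inverse z * y'"
    unfolding 1 2 using z by (simp_all add: algebra_simps)
  define g h where "g = 1 + q n * r (n + 1)" and "h = 1 - q (n + 1) * r (n + 1)"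
  have nz: "g \<noteq> 0" "h \<noteq> 0" "D n \<noteq> 0" "E (n - 1) \<noteq> 0" "D (n + 1) \<noteq> 0" "E n \<noteq> 0"
    using D_factor[of "n + 1"] E_factor D_nonzero E_nonzero by (auto simp: g_def h_def)
  have D: "D (n + 1) = h * D n" and E: "E n = g * E (n - 1)"
    by (simp_all only: D_Suc E_rec[of n] g_def h_def)
  have p: "p n * D (n + 1) = (q n - q (n + 1) - q n * q (n + 1) * r (n + 1)) * E (n - 1)"
    using nz by (simp add: p_pot_def)
  have s: "s n * E n = r (n + 1) * D n"
    using nz by (simp add: s_pot_def)
  have "E (n - 1) * (z * (x' + q n * y')) =
      z * (g * E (n - 1) * (h * x' + q (n + 1) * y') +
       (q n - q (n + 1) - q n * q (n + 1) * r (n + 1)) * E (n - 1) * (y' - r (n + 1) * x'))"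
    by (simp add: g_def h_def algebra_simps)
  also have "\<dots> = z * (E n * (h * x' + q (n + 1) * y') + p n * (D (n + 1) * (y' - r (n + 1) * x')))"
    by (simp only: E flip: p mult.assoc)
  finally have A: "E (n - 1) * ((1 - q n * r n) * x + q n * y) = \<dots>"
    by (simp only: half)
  have "D n * (inverse z * y') =
      inverse z * (r (n + 1) * D n * (h * x' + q (n + 1) * y') + h * D n * (y' - r (n + 1) * x'))"
    by (simp add: h_def algebra_simps)
  also have "\<dots> = inverse z * (s n * (E n * (h * x' + q (n + 1) * y')) + D (n + 1) * (y' - r (n + 1) * x'))"
    by (simp only: D flip: s mult.assoc)
  finally have B: "D n * (y - r n * x) = \<dots>"
    by (simp only: half)
  show "fst (gaugeP X z n) = z * (fst (gaugeP X z (n + 1)) + p n * snd (gaugeP X z (n + 1))) \<and>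
      snd (gaugeP X z n) = inverse z * (s n * fst (gaugeP X z (n + 1)) + snd (gaugeP X z (n + 1)))"
    using A B by (simp add: gaugeP_def xy h_def)
qed

text \<open>For the unknown (x, t y - r_n x) with t = 1 - z^-2 the step is Z times L(-r_n) R(q_n)
  L(r_{n+1}). Its off-diagonal entries are q_n and -r_n + r_{n+1} - q_n r_n r_{n+1}, the sources of
  u_n and v_n; its diagonal entries are g and h below.\<close>

lemma is_sol_gaugeU:
  assumes z: "z \<noteq> 0" and sol: "is_sol (Qsys q r) z (X z)"
  shows "is_sol (Usys u v) z (gaugeU X z)"
  unfolding is_sol_Usys_iff
proof
  fix n
  define x y x' y' where "x = fst (X z n)" "y = snd (X z n)" "x' = fst (X z (n + 1))" "y' = snd (X z (n + 1))"
  note xy = this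
  have 1: "x = z * x' + (z - inverse z) * q n * y'"
    and 2: "y = z * r n * x' + (inverse z + (z - inverse z) * q n * r n) * y'"
    using sol[unfolded is_sol_Qsys_iff, rule_format, of n] by (simp_all only: xy)
  define t where "t = 1 - inverse (z\<^sup>2)"
  \<comment> \<open>This makes y' enter the first equation only as t y', which suggests t y as the
    second unknown.\<close>
  have zt: "z - inverse z = z * t"
    using z by (simp add: t_def field_simps power2_eq_square)
  have y2: "y - r n * x = inverse z * y'"
    unfolding 1 2 by (simp add: algebra_simps)
  have x2: "x = z * (x' + q n * (t * y'))"
    unfolding 1 zt by (simp add: algebra_simps)
  have "t * y - r n * x = t * (y - r n * x) - inverse (z\<^sup>2) * r n * x"
    by (simp add: t_def algebra_simps)
  also have "\<dots> = inverse z * (t * y' - r n * (x' + q n * (t * y')))"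
    unfolding y2 unfolding x2 using z by (simp add: field_simps power2_eq_square)
  finally have half: "t * y - r n * x = inverse z * (t * y' - r n * (x' + q n * (t * y')))" .
  define g h where "g = 1 + q n * r (n + 1)" and "h = 1 - q n * r n"
  have nz: "g \<noteq> 0" "h \<noteq> 0" "D n \<noteq> 0" "E n \<noteq> 0"
    using D_factor E_factor D_nonzero E_nonzero by (auto simp: g_def h_def)
  have D: "D n = h * D (n - 1)" and E: "E n = g * E (n - 1)"
    by (simp_all only: D_rec[of n] E_rec[of n] g_def h_def)
  have u: "u n * D n = q n * E (n - 1)"
    using nz by (simp add: u_pot_def)
  have v: "v n * E n = (- r n + r (n + 1) - q n * r n * r (n + 1)) * D (n - 1)"
    using nz by (simp add: v_pot_def)
  have "E (n - 1) * (z * (x' + q n * (t * y'))) =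
      z * (g * E (n - 1) * x' + q n * E (n - 1) * (t * y' - r (n + 1) * x'))"
    by (simp add: g_def algebra_simps)
  also have "\<dots> = z * (E n * x' + u n * (D n * (t * y' - r (n + 1) * x')))"
    by (simp only: E flip: u mult.assoc)
  finally have A: "E (n - 1) * x = \<dots>"
    by (simp only: x2)
  have "D (n - 1) * (inverse z * (t * y' - r n * (x' + q n * (t * y')))) =
      inverse z * ((- r n + r (n + 1) - q n * r n * r (n + 1)) * D (n - 1) * x' + h * D (n - 1) * (t * y' - r (n + 1) * x'))"
    by (simp add: h_def algebra_simps)
  also have "\<dots> = inverse z * (v n * (E n * x') + D n * (t * y' - r (n + 1) * x'))"
    by (simp only: D flip: v mult.assoc)
  finally have B: "D (n - 1) * (t * y - r n * x) = \<dots>"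
    by (simp only: half)
  show "fst (gaugeU X z n) = z * (fst (gaugeU X z (n + 1)) + u n * snd (gaugeU X z (n + 1))) \<and>
      snd (gaugeU X z n) = inverse z * (v n * fst (gaugeU X z (n + 1)) + snd (gaugeU X z (n + 1)))"
    using A B by (simp add: gaugeU_def xy t_def)
qed

section \<open>Asymptotics of the gauge transforms at both ends\<close>

definition Dlim :: "int \<Rightarrow> complex" where
  "Dlim e = (if e = 1 then Dinf q r else 1)"

definition Elim :: "int \<Rightarrow> complex" where
  "Elim e = (if e = 1 then Einf q r else 1)"

lemma tendsto_along:
  assumes e: "e = 1 \<or> e = - 1"
  shows "(\<lambda>m. q (e * int m)) \<longlonglongrightarrow> 0" "(\<lambda>m. r (e * int m)) \<longlonglongrightarrow> 0"
    "(\<lambda>m. D (e * int m)) \<longlonglongrightarrow> Dlim e" "(\<lambda>m. D (e * int m - 1)) \<longlonglongrightarrow> Dlim e"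
    "(\<lambda>m. E (e * int m - 1)) \<longlonglongrightarrow> Elim e"
proof -
  show q0: "(\<lambda>m. q (e * int m)) \<longlonglongrightarrow> 0" and r0: "(\<lambda>m. r (e * int m)) \<longlonglongrightarrow> 0"
    using abs_summable_int_tendsto_0[OF q e, of 0] abs_summable_int_tendsto_0[OF r e, of 0] by simp_all
  have r1: "(\<lambda>m. r (e * int m + 1)) \<longlonglongrightarrow> 0"
    by (rule abs_summable_int_tendsto_0[OF r e])
  show D0: "(\<lambda>m. D (e * int m)) \<longlonglongrightarrow> Dlim e"
    using e Dp.left_prod_tendsto_pos Dp.left_prod_tendsto_neg
    by (auto simp: Dlim_def Dn_eq Dinf_eq)
  have E0: "(\<lambda>m. E (e * int m)) \<longlonglongrightarrow> Elim e"
    using e Ep.left_prod_tendsto_pos Ep.left_prod_tendsto_neg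
    by (auto simp: Elim_def En_eq Einf_eq)
  \<comment> \<open>Dividing by a factor that tends to 1 treats the index shift at both ends
    alike.\<close>
  have "D (e * int m - 1) = D (e * int m) / (1 - q (e * int m) * r (e * int m))" for m
    using D_rec[of "e * int m"] D_factor[of "e * int m"] by (simp add: field_simps)
  moreover have "(\<lambda>m. D (e * int m) / (1 - q (e * int m) * r (e * int m))) \<longlonglongrightarrow> Dlim e / (1 - 0 * 0)"
    by (intro tendsto_intros D0 q0 r0) simp
  ultimately show "(\<lambda>m. D (e * int m - 1)) \<longlonglongrightarrow> Dlim e"
    by simp
  have "E (e * int m - 1) = E (e * int m) / (1 + q (e * int m) * r (e * int m + 1))" for m
    using E_rec[of "e * int m"] E_factor[of "e * int m"] by (simp add: field_simps)
  moreover have "(\<lambda>m. E (e * int m) / (1 + q (e * int m) * r (e * int m + 1))) \<longlonglongrightarrow> Elim e / (1 + 0 * 0)"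
    by (intro tendsto_intros E0 q0 r1) simp
  ultimately show "(\<lambda>m. E (e * int m - 1)) \<longlonglongrightarrow> Elim e"
    by simp
qed

text \<open>The weight w need not converge, but having modulus 1 it cannot spoil the convergence to
  0 of the coefficient errors.\<close>

lemma tendsto_combination:
  fixes k l \<alpha> \<beta> w :: "nat \<Rightarrow> complex"
  assumes "\<And>m. cmod (w m) = 1" and k: "k \<longlonglongrightarrow> k0" and l: "l \<longlonglongrightarrow> l0"
    and \<alpha>: "(\<lambda>m. \<alpha> m - c * w m) \<longlonglongrightarrow> 0" and \<beta>: "(\<lambda>m. \<beta> m - d * w m) \<longlonglongrightarrow> 0"
  shows "(\<lambda>m. (k m * \<alpha> m + l m * \<beta> m) - (k0 * c + l0 * d) * w m) \<longlonglongrightarrow> 0"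
proof -
  have Z: "(\<lambda>m. x m * w m) \<longlonglongrightarrow> 0" if "x \<longlonglongrightarrow> 0" for x
    using tendsto_norm_zero[OF that]
    by (intro tendsto_norm_zero_cancel[where f = "\<lambda>m. x m * w m"]) (simp add: norm_mult assms(1))
  have "(\<lambda>m. k m * (\<alpha> m - c * w m) + l m * (\<beta> m - d * w m) +
      (((k m - k0) * c + (l m - l0) * d) * w m)) \<longlonglongrightarrow> k0 * 0 + l0 * 0 + 0"
  proof (intro tendsto_add tendsto_mult k l \<alpha> \<beta> Z)
    have "(\<lambda>m. (k m - k0) * c + (l m - l0) * d) \<longlonglongrightarrow> (k0 - k0) * c + (l0 - l0) * d"
      by (intro tendsto_intros k l)
    then show "(\<lambda>m. (k m - k0) * c + (l m - l0) * d) \<longlonglongrightarrow> 0"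
      by simp
  qed
  then show ?thesis
    by (simp add: algebra_simps)
qed

context
  fixes e w A B X c d
  assumes e: "e = 1 \<or> e = - 1" and w: "\<And>z m. cmod z = 1 \<Longrightarrow> cmod (w z m) = 1"
    and AB: "matched_regions A B" and X: "jost_like (Qsys q r) e c d w A B X"
begin

text \<open>The off-diagonal entries of the gauge contain q_n or r_n and die out, leaving the limits
  of E and D on the diagonal.\<close>

lemma jost_like_gaugeP:
  "jost_like (Usys p s) e (\<lambda>z. Elim e * c z) (\<lambda>z. Dlim e * d z) w A B (gaugeP X)"
  unfolding jost_like_def
proof (intro conjI allI impI)
  fix z :: complex assume z: "cmod z = 1"
  have sol: "is_sol (Qsys q r) z (X z)"
    and lim: "(\<lambda>m. fst (X z (e * int m)) - c z * w z m) \<longlonglongrightarrow> 0"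
      "(\<lambda>m. snd (X z (e * int m)) - d z * w z m) \<longlonglongrightarrow> 0"
    using X z by (auto simp: jost_like_def)
  show "is_sol (Usys p s) z (gaugeP X z)"
    using z sol by (intro is_sol_gaugeP) auto
  note t = tendsto_along[OF e]
  have "(\<lambda>m. E (e * int m - 1) * (1 - q (e * int m) * r (e * int m))) \<longlonglongrightarrow> Elim e * (1 - 0 * 0)"
    "(\<lambda>m. E (e * int m - 1) * q (e * int m)) \<longlonglongrightarrow> Elim e * 0"
    by (intro tendsto_intros t)+
  from tendsto_combination[OF w[OF z] this lim]
  show "(\<lambda>m. fst (gaugeP X z (e * int m)) - Elim e * c z * w z m) \<longlonglongrightarrow> 0"
    by (simp add: gaugeP_def algebra_simps)
  have "(\<lambda>m. - (D (e * int m) * r (e * int m))) \<longlonglongrightarrow> - (Dlim e * 0)"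
    "(\<lambda>m. D (e * int m)) \<longlonglongrightarrow> Dlim e"
    by (intro tendsto_intros t)+
  from tendsto_combination[OF w[OF z] this lim]
  show "(\<lambda>m. snd (gaugeP X z (e * int m)) - Dlim e * d z * w z m) \<longlonglongrightarrow> 0"
    by (simp add: gaugeP_def algebra_simps)
next
  have hol: "(\<lambda>z. fst (X z n)) holomorphic_on A" "(\<lambda>z. snd (X z n)) holomorphic_on A"
    and con: "continuous_on B (\<lambda>z. fst (X z n))" "continuous_on B (\<lambda>z. snd (X z n))" for n
    using X by (auto simp: jost_like_def ext_analytic_def)
  show "ext_analytic (gaugeP X) A B"
    unfolding ext_analytic_def gaugeP_def fst_conv snd_conv
    by (intro allI conjI holomorphic_on_mult holomorphic_on_add holomorphic_on_diff holomorphic_on_const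
        continuous_on_mult continuous_on_add continuous_on_diff continuous_on_const hol con)
qed

lemma jost_like_gaugeU:
  "jost_like (Usys u v) e (\<lambda>z. Elim e * c z) (\<lambda>z. (1 - inverse (z\<^sup>2)) * Dlim e * d z) w A B (gaugeU X)"
  unfolding jost_like_def
proof (intro conjI allI impI)
  fix z :: complex assume z: "cmod z = 1"
  have sol: "is_sol (Qsys q r) z (X z)"
    and lim: "(\<lambda>m. fst (X z (e * int m)) - c z * w z m) \<longlonglongrightarrow> 0"
      "(\<lambda>m. snd (X z (e * int m)) - d z * w z m) \<longlonglongrightarrow> 0"
    using X z by (auto simp: jost_like_def)
  show "is_sol (Usys u v) z (gaugeU X z)"
    using z sol by (intro is_sol_gaugeU) auto
  note t = tendsto_along[OF e]
  from tendsto_combination[OF w[OF z] t(5) tendsto_const[of 0] lim]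
  show "(\<lambda>m. fst (gaugeU X z (e * int m)) - Elim e * c z * w z m) \<longlonglongrightarrow> 0"
    by (simp add: gaugeU_def)
  have "(\<lambda>m. - (D (e * int m - 1) * r (e * int m))) \<longlonglongrightarrow> - (Dlim e * 0)"
    "(\<lambda>m. D (e * int m - 1) * (1 - inverse (z\<^sup>2))) \<longlonglongrightarrow> Dlim e * (1 - inverse (z\<^sup>2))"
    by (intro tendsto_intros t)+
  from tendsto_combination[OF w[OF z] this lim]
  show "(\<lambda>m. snd (gaugeU X z (e * int m)) - (1 - inverse (z\<^sup>2)) * Dlim e * d z * w z m) \<longlonglongrightarrow> 0"
    by (simp add: gaugeU_def algebra_simps)
next
  have hol: "(\<lambda>z. fst (X z n)) holomorphic_on A" "(\<lambda>z. snd (X z n)) holomorphic_on A"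
    and con: "continuous_on B (\<lambda>z. fst (X z n))" "continuous_on B (\<lambda>z. snd (X z n))" for n
    using X by (auto simp: jost_like_def ext_analytic_def)
  \<comment> \<open>Excluding 0 keeps z^-2 regular on both regions.\<close>
  have "0 \<notin> A" "0 \<notin> B"
    using AB by (auto simp: matched_regions_def)
  then have \<tau>: "(\<lambda>z. 1 - inverse (z\<^sup>2)) holomorphic_on A" "continuous_on B (\<lambda>z::complex. 1 - inverse (z\<^sup>2))"
    by (auto intro!: holomorphic_intros continuous_intros)
  show "ext_analytic (gaugeU X) A B"
    unfolding ext_analytic_def gaugeU_def fst_conv snd_conv
    by (intro allI conjI \<tau> holomorphic_on_mult holomorphic_on_diff holomorphic_on_const
        continuous_on_mult continuous_on_diff continuous_on_const hol con)
qed

end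

end

section \<open>Dependency constants\<close>

lemma vanishes_to_order_dep_consts:
  assumes dep: "dep_consts phi psi w m g" and w: "w \<in> A" "open A"
    and phi: "ext_analytic phi A B" and psi: "ext_analytic psi A B"
  shows "vanishes_to_order m w (\<lambda>z. fst (phi z n) - jet m w g z * fst (psi z n))"
    "vanishes_to_order m w (\<lambda>z. snd (phi z n) - jet m w g z * snd (psi z n))"
proof -
  have an: "(\<lambda>z. fst (phi z n)) analytic_on {w}" "(\<lambda>z. snd (phi z n)) analytic_on {w}"
    "(\<lambda>z. fst (psi z n)) analytic_on {w}" "(\<lambda>z. snd (psi z n)) analytic_on {w}"
    using phi psi w unfolding ext_analytic_def analytic_at by blast+
  show "vanishes_to_order m w (\<lambda>z. fst (phi z n) - jet m w g z * fst (psi z n))"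
    "vanishes_to_order m w (\<lambda>z. snd (phi z n) - jet m w g z * snd (psi z n))"
    using dep by (simp_all add: vanishes_to_order_diff_jet_iff an dep_consts_def)
qed

text \<open>Modulo order m, gauging phiQ = Gamma_Q psiQ gives hphi phiJ = Gamma_Q hpsi psiJ, while
  phiJ = Gamma_J psiJ. So (hphi Gamma_J - hpsi Gamma_Q) psiJ is 0, and psiJ can be cancelled where
  it is nonzero. One coordinate at one site n suffices; k and l are the entries of the gauge row
  producing it.\<close>

lemma dependency_transfer:
  fixes hphi hpsi k l :: "complex \<Rightarrow> complex"
  assumes depQ: "dep_consts phiQ psiQ w m gQ" and depJ: "dep_consts phiJ psiJ w m gJ"
    and ext: "ext_analytic phiQ A B" "ext_analytic psiQ A B" "ext_analytic phiJ A B" "ext_analytic psiJ A B"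
    and w: "w \<in> A" "open A"
    and hol: "k holomorphic_on A" "l holomorphic_on A" "hphi holomorphic_on A"
    and coord: "coord = fst \<or> coord = snd"
    and phi: "\<And>z. z \<in> A \<Longrightarrow> k z * fst (phiQ z n) + l z * snd (phiQ z n) = hphi z * coord (phiJ z n)"
    and psi: "\<And>z. z \<in> A \<Longrightarrow> k z * fst (psiQ z n) + l z * snd (psiQ z n) = hpsi z * coord (psiJ z n)"
    and nz: "coord (psiJ w n) \<noteq> 0"
  shows "vanishes_to_order m w (\<lambda>z. hphi z * jet m w gJ z - hpsi z * jet m w gQ z)"
proof (rule vanishes_to_order_cancel[where h = "\<lambda>z. coord (psiJ z n)"])
  show "coord (psiJ w n) \<noteq> 0"
    by (rule nz)
  have an: "k analytic_on {w}" "l analytic_on {w}" "hphi analytic_on {w}"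
    using hol w unfolding analytic_at by blast+
  show "(\<lambda>z. coord (psiJ z n)) analytic_on {w}"
    using coord ext(4) w unfolding ext_analytic_def analytic_at by blast
  note vQ = vanishes_to_order_dep_consts[OF depQ w ext(1,2), of n]
  have vJ: "vanishes_to_order m w (\<lambda>z. coord (phiJ z n) - jet m w gJ z * coord (psiJ z n))"
    using vanishes_to_order_dep_consts[OF depJ w ext(3,4), of n] coord by auto
  show "vanishes_to_order m w
      (\<lambda>z. coord (psiJ z n) * (hphi z * jet m w gJ z - hpsi z * jet m w gQ z))"
  proof (rule vanishes_to_order_transform)
    show "vanishes_to_order m w (\<lambda>z.
        k z * (fst (phiQ z n) - jet m w gQ z * fst (psiQ z n)) +
        l z * (snd (phiQ z n) - jet m w gQ z * snd (psiQ z n)) -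
        hphi z * (coord (phiJ z n) - jet m w gJ z * coord (psiJ z n)))"
      by (intro vanishes_to_order_diff vanishes_to_order_add vanishes_to_order_mult vQ vJ an)
    have "eventually (\<lambda>z. z \<in> A) (nhds w)"
      using w by (simp add: eventually_nhds_in_open)
    then show "eventually (\<lambda>z.
        k z * (fst (phiQ z n) - jet m w gQ z * fst (psiQ z n)) +
        l z * (snd (phiQ z n) - jet m w gQ z * snd (psiQ z n)) -
        hphi z * (coord (phiJ z n) - jet m w gJ z * coord (psiJ z n)) =
        coord (psiJ z n) * (hphi z * jet m w gJ z - hpsi z * jet m w gQ z)) (nhds w)"
    proof eventually_elim
      case (elim z)
      have "k z * (fst (phiQ z n) - jet m w gQ z * fst (psiQ z n)) +
        l z * (snd (phiQ z n) - jet m w gQ z * snd (psiQ z n)) =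
        (k z * fst (phiQ z n) + l z * snd (phiQ z n)) -
        jet m w gQ z * (k z * fst (psiQ z n) + l z * snd (psiQ z n))"
        by (simp add: algebra_simps)
      then show ?case
        unfolding phi[OF elim] psi[OF elim] by (simp add: algebra_simps)
    qed
  qed
qed

lemma higher_deriv_mult_jet:
  assumes "h analytic_on {w}" "k < m"
  shows "(deriv ^^ k) (\<lambda>z. h z * jet m w g z) w =
    (\<Sum>l\<le>k. of_nat (k choose l) * (deriv ^^ l) h w * g (k - l))"
  using assms by (subst higher_deriv_mult_at)
    (auto simp: analytic_jet higher_deriv_jet atLeast0AtMost intro!: sum.cong)

lemma higher_deriv_cmult_jet:
  assumes "k < m"
  shows "(deriv ^^ k) (\<lambda>z. c * jet m w g z) w = c * g k"
  using assms by (simp add: higher_deriv_cmult' analytic_jet higher_deriv_jet)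

lemma vanishes_to_order_imp_higher_deriv_eq:
  assumes "vanishes_to_order m w (\<lambda>z. f z - g z)" "f analytic_on {w}" "g analytic_on {w}" "k < m"
  shows "(deriv ^^ k) f w = (deriv ^^ k) g w"
  using assms by (simp add: vanishes_to_order_def higher_deriv_diff_at)

lemma sigma_analytic:
  assumes "w \<noteq> 0" "w\<^sup>2 \<noteq> 1"
  shows "sigma analytic_on {w}"
  unfolding sigma_def using assms by (intro analytic_intros) (auto simp: divide_simps)

lemma eventually_sigma_mult:
  assumes "w \<noteq> 0" "w\<^sup>2 \<noteq> 1"
  shows "eventually (\<lambda>z. sigma z * (1 - inverse (z\<^sup>2)) = 1) (nhds w)"
proof -
  have "isCont (\<lambda>z. 1 - inverse (z\<^sup>2)) w"
    using assms by (intro continuous_intros) auto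
  moreover have "1 - inverse (w\<^sup>2) \<noteq> 0"
    using assms by (auto simp: divide_simps)
  ultimately have "eventually (\<lambda>z. 1 - inverse (z\<^sup>2) \<noteq> 0) (nhds w)"
    by (rule isCont_imp_eventually_nonzero)
  then show ?thesis
    by eventually_elim (simp add: sigma_def)
qed

text \<open>The poles 1 and -1 of \<open>sigma\<close> lie on the circle, away from z_j and its
  outer counterpart.\<close>

lemma norm_ne_1_imp_square_ne_1:
  fixes w :: complex
  assumes "cmod w \<noteq> 1"
  shows "w\<^sup>2 \<noteq> 1"
  using assms by (auto simp: power2_eq_1_iff)

lemma open_inner_reg: "open inner_reg" and open_outer_reg: "open outer_reg"
  by (intro open_Collect_conj open_Collect_less continuous_intros)+

lemma holomorphic_tau: "0 \<notin> A \<Longrightarrow> (\<lambda>z. 1 - inverse (z\<^sup>2)) holomorphic_on A"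
  by (auto intro!: holomorphic_intros)

lemma continuous_tau: "0 \<notin> A \<Longrightarrow> continuous_on A (\<lambda>z::complex. 1 - inverse (z\<^sup>2))"
  by (auto intro!: continuous_intros)

lemma matched_inner: "matched_regions inner_reg inner_cl" and matched_outer: "matched_regions outer_reg outer_cl"
  by (simp_all add: matched_regions_def)

section \<open>Scalar factors of the gauged Jost solutions\<close>

context Q_potentials
begin

text \<open>Inside the circle the second component is compared, outside it the first: these are the
  components in which psi, respectively psib, is known to be nonzero at some site.\<close>

lemma gauge_phi:
  assumes Q: "jost_phi (Qsys q r) phiQ" and z: "z \<in> inner_reg"
  shows "jost_phi (Usys p s) phiP \<Longrightarrow> snd (gaugeP phiQ z n) = snd (phiP z n)"
    and "jost_phi (Usys u v) phiU \<Longrightarrow> snd (gaugeU phiQ z n) = snd (phiU z n)"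
proof -
  note * = jost_phi_imp_jost_like[OF Q]
  show "snd (gaugeP phiQ z n) = snd (phiP z n)" if "jost_phi (Usys p s) phiP"
    using PS.jost_like_proportional(2)[where h = "\<lambda>_. 1", OF _ matched_inner
        jost_phi_imp_jost_like[OF that] jost_like_gaugeP[OF _ _ matched_inner *] _ _ _ _ z]
    by (simp add: Elim_def Dlim_def norm_power_int norm_power)
  show "snd (gaugeU phiQ z n) = snd (phiU z n)" if "jost_phi (Usys u v) phiU"
    using UV.jost_like_proportional(2)[where h = "\<lambda>_. 1", OF _ matched_inner
        jost_phi_imp_jost_like[OF that] jost_like_gaugeU[OF _ _ matched_inner *] _ _ _ _ z]
    by (simp add: Elim_def Dlim_def norm_power_int norm_power)
qed

lemma gauge_psi:
  assumes Q: "jost_psi (Qsys q r) psiQ" and z: "z \<in> inner_reg"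
  shows "jost_psi (Usys p s) psiP \<Longrightarrow> snd (gaugeP psiQ z n) = Dinf q r * snd (psiP z n)"
    and "jost_psi (Usys u v) psiU \<Longrightarrow>
      snd (gaugeU psiQ z n) = (1 - inverse (z\<^sup>2)) * Dinf q r * snd (psiU z n)"
proof -
  note * = jost_psi_imp_jost_like[OF Q]
  show "snd (gaugeP psiQ z n) = Dinf q r * snd (psiP z n)" if "jost_psi (Usys p s) psiP"
    using PS.jost_like_proportional(2)[where h = "\<lambda>_. Dinf q r", OF _ matched_inner
        jost_psi_imp_jost_like[OF that] jost_like_gaugeP[OF _ _ matched_inner *] _ _ _ _ z]
    by (simp add: Elim_def Dlim_def norm_power_int norm_power)
  show "snd (gaugeU psiQ z n) = (1 - inverse (z\<^sup>2)) * Dinf q r * snd (psiU z n)"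
    if "jost_psi (Usys u v) psiU"
    using UV.jost_like_proportional(2)[where h = "\<lambda>z. (1 - inverse (z\<^sup>2)) * Dinf q r", OF _ matched_inner
        jost_psi_imp_jost_like[OF that] jost_like_gaugeU[OF _ _ matched_inner *] _ _ _ _ z]
    by (simp add: Elim_def Dlim_def norm_power_int norm_power holomorphic_on_mult holomorphic_tau
        continuous_on_mult continuous_tau)
qed

lemma gauge_phib:
  assumes Q: "jost_phib (Qsys q r) phibQ" and z: "z \<in> outer_reg"
  shows "jost_phib (Usys p s) phibP \<Longrightarrow> fst (gaugeP phibQ z n) = fst (phibP z n)"
    and "jost_phib (Usys u v) phibU \<Longrightarrow> fst (gaugeU phibQ z n) = (1 - inverse (z\<^sup>2)) * fst (phibU z n)"
proof -
  note * = jost_phib_imp_jost_like[OF Q]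
  show "fst (gaugeP phibQ z n) = fst (phibP z n)" if "jost_phib (Usys p s) phibP"
    using PS.jost_like_proportional(1)[where h = "\<lambda>_. 1", OF _ matched_outer
        jost_phib_imp_jost_like[OF that] jost_like_gaugeP[OF _ _ matched_outer *] _ _ _ _ z]
    by (simp add: Elim_def Dlim_def norm_power_int norm_power)
  show "fst (gaugeU phibQ z n) = (1 - inverse (z\<^sup>2)) * fst (phibU z n)" if "jost_phib (Usys u v) phibU"
    using UV.jost_like_proportional(1)[where h = "\<lambda>z. 1 - inverse (z\<^sup>2)", OF _ matched_outer
        jost_phib_imp_jost_like[OF that] jost_like_gaugeU[OF _ _ matched_outer *] _ _ _ _ z]
    by (simp add: Elim_def Dlim_def norm_power_int norm_power holomorphic_tau continuous_tau)
qed

lemma gauge_psib: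
  assumes Q: "jost_psib (Qsys q r) psibQ" and z: "z \<in> outer_reg"
  shows "jost_psib (Usys p s) psibP \<Longrightarrow> fst (gaugeP psibQ z n) = Einf q r * fst (psibP z n)"
    and "jost_psib (Usys u v) psibU \<Longrightarrow> fst (gaugeU psibQ z n) = Einf q r * fst (psibU z n)"
proof -
  note * = jost_psib_imp_jost_like[OF Q]
  show "fst (gaugeP psibQ z n) = Einf q r * fst (psibP z n)" if "jost_psib (Usys p s) psibP"
    using PS.jost_like_proportional(1)[where h = "\<lambda>_. Einf q r", OF _ matched_outer
        jost_psib_imp_jost_like[OF that] jost_like_gaugeP[OF _ _ matched_outer *] _ _ _ _ z]
    by (simp add: Elim_def Dlim_def norm_power_int norm_power)
  show "fst (gaugeU psibQ z n) = Einf q r * fst (psibU z n)" if "jost_psib (Usys u v) psibU"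
    using UV.jost_like_proportional(1)[where h = "\<lambda>_. Einf q r", OF _ matched_outer
        jost_psib_imp_jost_like[OF that] jost_like_gaugeU[OF _ _ matched_outer *] _ _ _ _ z]
    by (simp add: Elim_def Dlim_def norm_power_int norm_power)
qed

section \<open>Relations between the dependency constants of the three systems\<close>

lemma dep_consts_P:
  assumes Q: "jost_phi (Qsys q r) phiQ" "jost_psi (Qsys q r) psiQ" "dep_consts phiQ psiQ w m gQ"
    and P: "jost_phi (Usys p s) phiP" "jost_psi (Usys p s) psiP" "dep_consts phiP psiP w m gP"
    and w: "w \<in> inner_reg" and k: "k < m"
  shows "gP k = Dinf q r * gQ k"
proof -
  obtain n where n: "snd (psiP w n) \<noteq> 0"
    using PS.jost_psi_nonzero[OF P(2) w] by blast
  have v: "vanishes_to_order m w (\<lambda>z. 1 * jet m w gP z - Dinf q r * jet m w gQ z)"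
  \<comment> \<open>The coefficients form the second row of the gauge matrix.\<close>
  proof (rule dependency_transfer[OF Q(3) P(3) _ _ _ _ w open_inner_reg _ _ _ disjI2[OF refl] _ _ n,
        where k = "\<lambda>_. - (D n * r n)" and l = "\<lambda>_. D n"])
    fix z :: complex assume z: "z \<in> inner_reg"
    show "- (D n * r n) * fst (phiQ z n) + D n * snd (phiQ z n) = 1 * snd (phiP z n)"
      using gauge_phi(1)[OF Q(1) z P(1), of n] by (simp add: gaugeP_def algebra_simps)
    show "- (D n * r n) * fst (psiQ z n) + D n * snd (psiQ z n) = Dinf q r * snd (psiP z n)"
      using gauge_psi(1)[OF Q(2) z P(2), of n] by (simp add: gaugeP_def algebra_simps)
  qed (use Q P in \<open>auto simp: jost_phi_def jost_psi_def\<close>)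
  \<comment> \<open>The factor 1 is kept so that both sides are instances of
    \<open>higher_deriv_cmult_jet\<close>.\<close>
  have "(deriv ^^ k) (\<lambda>z. 1 * jet m w gP z) w = (deriv ^^ k) (\<lambda>z. Dinf q r * jet m w gQ z) w"
    by (rule vanishes_to_order_imp_higher_deriv_eq[OF v _ _ k])
      (intro analytic_on_mult analytic_on_const analytic_jet)+
  then show ?thesis
    unfolding higher_deriv_cmult_jet[OF k] by (simp only: mult_1)
qed

lemma dep_consts_U:
  assumes Q: "jost_phi (Qsys q r) phiQ" "jost_psi (Qsys q r) psiQ" "dep_consts phiQ psiQ w m gQ"
    and U: "jost_phi (Usys u v) phiU" "jost_psi (Usys u v) psiU" "dep_consts phiU psiU w m gU"
    and w: "w \<in> inner_reg" and k: "k < m"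
  shows "Dinf q r * gQ k = (\<Sum>l\<le>k. of_nat (k choose l) * (deriv ^^ l) sigma w * gU (k - l))"
proof -
  have w1: "w \<noteq> 0" "w\<^sup>2 \<noteq> 1"
    using w norm_ne_1_imp_square_ne_1[of w] by auto
  obtain n where n: "snd (psiU w n) \<noteq> 0"
    using UV.jost_psi_nonzero[OF U(2) w] by blast
  have "vanishes_to_order m w (\<lambda>z. 1 * jet m w gU z - (1 - inverse (z\<^sup>2)) * Dinf q r * jet m w gQ z)"
  proof (rule dependency_transfer[OF Q(3) U(3) _ _ _ _ w open_inner_reg _ _ _ disjI2[OF refl] _ _ n,
        where k = "\<lambda>_. - (D (n - 1) * r n)" and l = "\<lambda>z. D (n - 1) * (1 - inverse (z\<^sup>2))"])
    fix z :: complex assume z: "z \<in> inner_reg"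
    show "- (D (n - 1) * r n) * fst (phiQ z n) + D (n - 1) * (1 - inverse (z\<^sup>2)) * snd (phiQ z n) =
        1 * snd (phiU z n)"
      using gauge_phi(2)[OF Q(1) z U(1), of n] by (simp add: gaugeU_def algebra_simps)
    show "- (D (n - 1) * r n) * fst (psiQ z n) + D (n - 1) * (1 - inverse (z\<^sup>2)) * snd (psiQ z n) =
        (1 - inverse (z\<^sup>2)) * Dinf q r * snd (psiU z n)"
      using gauge_psi(2)[OF Q(2) z U(2), of n] by (simp add: gaugeU_def algebra_simps)
  next
    show "(\<lambda>z. D (n - 1) * (1 - inverse (z\<^sup>2))) holomorphic_on inner_reg"
      by (intro holomorphic_on_mult holomorphic_on_const holomorphic_tau) auto
  qed (use Q U in \<open>auto simp: jost_phi_def jost_psi_def\<close>)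
  \<comment> \<open>Near w, \<open>sigma\<close> inverts 1 - z^-2; it thus moves from the (Q) side
    to the (u,v) side.\<close>
  then have "vanishes_to_order m w (\<lambda>z. sigma z *
      (1 * jet m w gU z - (1 - inverse (z\<^sup>2)) * Dinf q r * jet m w gQ z))"
    by (rule vanishes_to_order_mult[OF _ sigma_analytic[OF w1]])
  moreover from eventually_sigma_mult[OF w1]
  have "eventually (\<lambda>z. sigma z * (1 * jet m w gU z - (1 - inverse (z\<^sup>2)) * Dinf q r * jet m w gQ z) =
      sigma z * jet m w gU z - Dinf q r * jet m w gQ z) (nhds w)"
  proof eventually_elim
    case (elim z)
    have "sigma z * (1 * jet m w gU z - (1 - inverse (z\<^sup>2)) * Dinf q r * jet m w gQ z) =
        sigma z * jet m w gU z - (sigma z * (1 - inverse (z\<^sup>2))) * (Dinf q r * jet m w gQ z)"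
      by (simp add: algebra_simps)
    then show ?case
      by (simp only: elim mult_1)
  qed
  ultimately have v: "vanishes_to_order m w (\<lambda>z. sigma z * jet m w gU z - Dinf q r * jet m w gQ z)"
    by (rule vanishes_to_order_transform)
  have "(deriv ^^ k) (\<lambda>z. sigma z * jet m w gU z) w = (deriv ^^ k) (\<lambda>z. Dinf q r * jet m w gQ z) w"
    by (rule vanishes_to_order_imp_higher_deriv_eq[OF v _ _ k])
      (intro analytic_on_mult analytic_on_const analytic_jet sigma_analytic w1)+
  then show ?thesis
    unfolding higher_deriv_cmult_jet[OF k] higher_deriv_mult_jet[OF sigma_analytic[OF w1] k] by (rule sym)
qed

lemma dep_consts_P_bar:
  assumes Q: "jost_phib (Qsys q r) phibQ" "jost_psib (Qsys q r) psibQ" "dep_consts phibQ psibQ w m gQ"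
    and P: "jost_phib (Usys p s) phibP" "jost_psib (Usys p s) psibP" "dep_consts phibP psibP w m gP"
    and w: "w \<in> outer_reg" and k: "k < m"
  shows "gP k = Einf q r * gQ k"
proof -
  obtain n where n: "fst (psibP w n) \<noteq> 0"
    using PS.jost_psib_nonzero[OF P(2) w] by blast
  have v: "vanishes_to_order m w (\<lambda>z. 1 * jet m w gP z - Einf q r * jet m w gQ z)"
  \<comment> \<open>Outside the circle the first row of the gauge matrix is used.\<close>
  proof (rule dependency_transfer[OF Q(3) P(3) _ _ _ _ w open_outer_reg _ _ _ disjI1[OF refl] _ _ n,
        where k = "\<lambda>_. E (n - 1) * (1 - q n * r n)" and l = "\<lambda>_. E (n - 1) * q n"])
    fix z :: complex assume z: "z \<in> outer_reg"
    show "E (n - 1) * (1 - q n * r n) * fst (phibQ z n) + E (n - 1) * q n * snd (phibQ z n) = 1 * fst (phibP z n)"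
      using gauge_phib(1)[OF Q(1) z P(1), of n] by (simp add: gaugeP_def algebra_simps)
    show "E (n - 1) * (1 - q n * r n) * fst (psibQ z n) + E (n - 1) * q n * snd (psibQ z n) =
        Einf q r * fst (psibP z n)"
      using gauge_psib(1)[OF Q(2) z P(2), of n] by (simp add: gaugeP_def algebra_simps)
  qed (use Q P in \<open>auto simp: jost_phib_def jost_psib_def\<close>)
  have "(deriv ^^ k) (\<lambda>z. 1 * jet m w gP z) w = (deriv ^^ k) (\<lambda>z. Einf q r * jet m w gQ z) w"
    by (rule vanishes_to_order_imp_higher_deriv_eq[OF v _ _ k])
      (intro analytic_on_mult analytic_on_const analytic_jet)+
  then show ?thesis
    unfolding higher_deriv_cmult_jet[OF k] by (simp only: mult_1)
qed

lemma dep_consts_U_bar: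
  assumes Q: "jost_phib (Qsys q r) phibQ" "jost_psib (Qsys q r) psibQ" "dep_consts phibQ psibQ w m gQ"
    and U: "jost_phib (Usys u v) phibU" "jost_psib (Usys u v) psibU" "dep_consts phibU psibU w m gU"
    and w: "w \<in> outer_reg" and k: "k < m"
  shows "gU k = Einf q r * (\<Sum>l\<le>k. of_nat (k choose l) * (deriv ^^ l) sigma w * gQ (k - l))"
proof -
  have w1: "w \<noteq> 0" "w\<^sup>2 \<noteq> 1"
    using w norm_ne_1_imp_square_ne_1[of w] by auto
  obtain n where n: "fst (psibU w n) \<noteq> 0"
    using UV.jost_psib_nonzero[OF U(2) w] by blast
  have "vanishes_to_order m w (\<lambda>z. (1 - inverse (z\<^sup>2)) * jet m w gU z - Einf q r * jet m w gQ z)"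
  proof (rule dependency_transfer[OF Q(3) U(3) _ _ _ _ w open_outer_reg _ _ _ disjI1[OF refl] _ _ n,
        where k = "\<lambda>_. E (n - 1)" and l = "\<lambda>_. 0"])
    fix z :: complex assume z: "z \<in> outer_reg"
    show "E (n - 1) * fst (phibQ z n) + 0 * snd (phibQ z n) = (1 - inverse (z\<^sup>2)) * fst (phibU z n)"
      using gauge_phib(2)[OF Q(1) z U(1), of n] by (simp add: gaugeU_def)
    show "E (n - 1) * fst (psibQ z n) + 0 * snd (psibQ z n) = Einf q r * fst (psibU z n)"
      using gauge_psib(2)[OF Q(2) z U(2), of n] by (simp add: gaugeU_def)
  next
    show "(\<lambda>z. 1 - inverse (z\<^sup>2)) holomorphic_on outer_reg"
      by (rule holomorphic_tau) auto
  qed (use Q U in \<open>auto simp: jost_phib_def jost_psib_def\<close>)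
  \<comment> \<open>Here 1 - z^-2 stands with the constants of (u,v), so \<open>sigma\<close> ends
    up with those of (Q).\<close>
  then have "vanishes_to_order m w (\<lambda>z. sigma z *
      ((1 - inverse (z\<^sup>2)) * jet m w gU z - Einf q r * jet m w gQ z))"
    by (rule vanishes_to_order_mult[OF _ sigma_analytic[OF w1]])
  moreover from eventually_sigma_mult[OF w1]
  have "eventually (\<lambda>z. sigma z * ((1 - inverse (z\<^sup>2)) * jet m w gU z - Einf q r * jet m w gQ z) =
      1 * jet m w gU z - Einf q r * (sigma z * jet m w gQ z)) (nhds w)"
  proof eventually_elim
    case (elim z)
    have "sigma z * ((1 - inverse (z\<^sup>2)) * jet m w gU z - Einf q r * jet m w gQ z) =
        (sigma z * (1 - inverse (z\<^sup>2))) * jet m w gU z - Einf q r * (sigma z * jet m w gQ z)"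
      by (simp add: algebra_simps)
    then show ?case
      by (simp only: elim)
  qed
  ultimately have v: "vanishes_to_order m w (\<lambda>z. 1 * jet m w gU z - Einf q r * (sigma z * jet m w gQ z))"
    by (rule vanishes_to_order_transform)
  have an: "(\<lambda>z. sigma z * jet m w gQ z) analytic_on {w}"
    by (intro analytic_on_mult sigma_analytic[OF w1] analytic_jet)
  have "(deriv ^^ k) (\<lambda>z. 1 * jet m w gU z) w =
      (deriv ^^ k) (\<lambda>z. Einf q r * (sigma z * jet m w gQ z)) w"
    by (rule vanishes_to_order_imp_higher_deriv_eq[OF v _ _ k])
      (intro analytic_on_mult analytic_on_const analytic_jet an)+
  then show ?thesis
    unfolding higher_deriv_cmult_jet[OF k] higher_deriv_cmult'[OF an]
      higher_deriv_mult_jet[OF sigma_analytic[OF w1] k]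
    by (simp only: mult_1)
qed

end

theorem theorem4p2:
  fixes q r :: "int \<Rightarrow> complex"
    and psiQ phiQ psibQ phibQ psiU phiU psibU phibU psiP phiP psibP phibP
      :: "complex \<Rightarrow> int \<Rightarrow> complex \<times> complex"
    and TQ TbQ TU TbU TP TbP :: "complex \<Rightarrow> complex"
    and zj zbj :: complex and mj mbj :: nat
    and gQ gU gP gbQ gbU gbP :: "nat \<Rightarrow> complex"
  assumes "rapid_decay q" and "rapid_decay r"
    and "\<forall>n. 1 - q n * r n \<noteq> 0" and "\<forall>n. 1 + q n * r (n + 1) \<noteq> 0"
    and "jost_data (Qsys q r) psiQ phiQ psibQ phibQ TQ TbQ"
    and "jost_data (Usys (u_pot q r) (v_pot q r)) psiU phiU psibU phibU TU TbU"
    and "jost_data (Usys (p_pot q r) (s_pot q r)) psiP phiP psibP phibP TP TbP"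
    and "0 < cmod zj" and "cmod zj < 1"
    and "pole_mult TQ zj mj" and "pole_mult TU zj mj" and "pole_mult TP zj mj"
    and "1 < cmod zbj"
    and "pole_mult TbQ zbj mbj" and "pole_mult TbU zbj mbj" and "pole_mult TbP zbj mbj"
    and "dep_consts phiQ psiQ zj mj gQ"
    and "dep_consts phiU psiU zj mj gU"
    and "dep_consts phiP psiP zj mj gP"
    and "dep_consts phibQ psibQ zbj mbj gbQ"
    and "dep_consts phibU psibU zbj mbj gbU"
    and "dep_consts phibP psibP zbj mbj gbP"
  shows "(\<forall>k<mj. Dinf q r * gQ k = gP k \<and>
            Dinf q r * gQ k = (\<Sum>l\<le>k. of_nat (k choose l) * (deriv ^^ l) sigma zj * gU (k - l))) \<and>
         (\<forall>k<mbj. gbP k = Einf q r * gbQ k \<and>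
            gbU k = Einf q r * (\<Sum>l\<le>k. of_nat (k choose l) * (deriv ^^ l) sigma zbj * gbQ (k - l)))"
proof -
  interpret Q_potentials q r
    by unfold_locales (use assms(1-4) in \<open>auto intro: rapid_decay_imp_abs_summable\<close>)
  note jost = assms(5-7)[unfolded jost_data_def]
  have zj: "zj \<in> inner_reg" and zbj: "zbj \<in> outer_reg"
    using assms by auto
  show ?thesis
  proof (intro conjI allI impI)
    fix k assume k: "k < mj"
    show "Dinf q r * gQ k = gP k"
      using jost by (intro dep_consts_P[OF _ _ assms(17) _ _ assms(19) zj k, symmetric]) auto
    show "Dinf q r * gQ k = (\<Sum>l\<le>k. of_nat (k choose l) * (deriv ^^ l) sigma zj * gU (k - l))"
      using jost by (intro dep_consts_U[OF _ _ assms(17) _ _ assms(18) zj k]) auto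
  next
    fix k assume k: "k < mbj"
    show "gbP k = Einf q r * gbQ k"
      using jost by (intro dep_consts_P_bar[OF _ _ assms(20) _ _ assms(22) zbj k]) auto
    show "gbU k = Einf q r * (\<Sum>l\<le>k. of_nat (k choose l) * (deriv ^^ l) sigma zbj * gbQ (k - l))"
      using jost by (intro dep_consts_U_bar[OF _ _ assms(20) _ _ assms(21) zbj k]) auto
  qed
qed

end
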